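(* Let $f_i:\mathbb{R}^n\to\mathbb{R}$, $i=1,\dots,N$, be continuously differentiable with globally Lipschitz gradients $\nabla f_i$ (the $f_i$ need not be convex), and suppose $F(w)=\frac1N\sum_{i=1}^N f_i(w)$ is strongly convex with parameter $\alpha>0$; let $w^*$ be its minimizer. Let $N$ agents communicate over an undirected connected graph, where $\mathcal{N}_i$ is the set of neighbors of agent $i$, and consider, with $w_i,\xi_i\in\mathbb{R}^n$ and arbitrary initial conditions, $$\dot w_i=-\nabla f_i(w_i)+k_{\mathrm P}\sum_{j\in\mathcal{N}_i}(w_j-w_i)+k_{\mathrm I}\sum_{j\in\mathcal{N}_i}(\xi_j-\xi_i),\qquad \dot\xi_i=-k_{\mathrm I}\sum_{j\in\mathcal{N}_i}(w_j-w_i),\qquad i=1,\dots,N.$$ This distributed algorithm solves the problem $\min_{w}F(w)$ in the following sense. (a) For every $k_{\mathrm I}>0$ and all sufficiently large $k_{\mathrm P}$ (depending on $k_{\mathrm I}$), $w_i(t)\to w^*$ as $t\to\infty$ for all $i=1,\dots,N$. (b) The convergence rate of the algorithm can be made arbitrarily close to the convergence rate of the centralized gradient descent method $\dot{\bar w}=-\nabla F(\bar w)$ if $k_{\mathrm P}=k_{\mathrm I}^{3/2}$ and $k_{\mathrm I}$ is sufficiently large. That is, if $w^*$ is globally exponentially stable with rate $\mu>0$ for $\dot{\bar w}=-\nabla F(\bar w)$, then for every $\upsilon\in(0,\mu)$ there is $\bar k>0$ such that, for all $k_{\mathrm I}>\bar k$ and $k_{\mathrm P}=k_{\mathrm I}^{3/2}$,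 every $w_i(t)$ converges to $w^*$ exponentially fast at least with the rate $\mu-\upsilon$.
   Context: $F:\mathbb{R}^n\to\mathbb{R}$ is strongly convex with parameter $\alpha$ if $(\nabla F(w)-\nabla F(w_0))^\top(w-w_0)\ge\alpha|w-w_0|^2$ for all $w,w_0$, where $|\cdot|$ is the Euclidean norm. An equilibrium $p^*$ of a system $\dot p=g(p)$ is globally exponentially stable with rate $\mu$ if there is a constant $c$ such that all solutions satisfy $|p(t)-p^*|\le c\,e^{-\mu t}|p(0)-p^*|$ for $t\ge0$. A function $p(t)$ converges to $p^*$ exponentially fast at least with the rate $r>0$ if there is a constant $C$ with $|p(t)-p^*|\le Ce^{-rt}$ for all $t\ge0$. *)

theory Defs
  imports "HOL-Analysis.Analysis"
begin

definition gradient :: "('a::euclidean_space \<Rightarrow> real) \<Rightarrow> 'a \<Rightarrow> 'a" where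
  "gradient f x = (THE D. GDERIV f x :> D)"

definition continuously_differentiable :: "('a::euclidean_space \<Rightarrow> real) \<Rightarrow> bool" where
  "continuously_differentiable f \<longleftrightarrow>
     (\<forall>x. f differentiable (at x)) \<and> continuous_on UNIV (gradient f)"

definition strongly_convex :: "real \<Rightarrow> ('a::euclidean_space \<Rightarrow> real) \<Rightarrow> bool" where
  "strongly_convex \<alpha> F \<longleftrightarrow>
     (\<forall>w w0. (gradient F w - gradient F w0) \<bullet> (w - w0) \<ge> \<alpha> * (norm (w - w0))\<^sup>2)"

definition solution_of :: "('a::real_normed_vector \<Rightarrow> 'a) \<Rightarrow> (real \<Rightarrow> 'a) \<Rightarrow> bool" where
  "solution_of g p \<longleftrightarrow> (\<forall>t\<ge>0. (p has_vector_derivative g (p t)) (at t within {0..}))"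

definition globally_exponentially_stable ::
  "('a::real_normed_vector \<Rightarrow> 'a) \<Rightarrow> 'a \<Rightarrow> real \<Rightarrow> bool" where
  "globally_exponentially_stable g pstar \<mu> \<longleftrightarrow>
     g pstar = 0 \<and>
     (\<exists>c. \<forall>p. solution_of g p \<longrightarrow>
        (\<forall>t\<ge>0. norm (p t - pstar) \<le> c * exp (- \<mu> * t) * norm (p 0 - pstar)))"

definition converges_exponentially ::
  "(real \<Rightarrow> 'a::real_normed_vector) \<Rightarrow> 'a \<Rightarrow> real \<Rightarrow> bool" where
  "converges_exponentially p pstar r \<longleftrightarrow>
     (\<exists>C. \<forall>t\<ge>0. norm (p t - pstar) \<le> C * exp (- r * t))"

definition average_objective :: "('v::finite \<Rightarrow> 'a \<Rightarrow> real) \<Rightarrow> 'a \<Rightarrow> real" where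
  "average_objective f w = (\<Sum>i\<in>UNIV. f i w) / real CARD('v)"

text \<open>A simple undirected graph on the vertex type is given by its set of arcs: each edge
  contributes both ordered pairs of its end points, so the neighbours of \<open>i\<close> are \<open>E `` {i}\<close>.\<close>

definition connected_undirected_graph :: "('v \<times> 'v) set \<Rightarrow> bool" where
  "connected_undirected_graph E \<longleftrightarrow> sym E \<and> irrefl E \<and> (\<forall>i j. (i, j) \<in> E\<^sup>*)"

definition distributed_pi_solution ::
  "('v::finite \<Rightarrow> 'a::euclidean_space \<Rightarrow> real) \<Rightarrow> ('v \<times> 'v) set \<Rightarrow> real \<Rightarrow> real \<Rightarrow>
   ('v \<Rightarrow> real \<Rightarrow> 'a) \<Rightarrow> ('v \<Rightarrow> real \<Rightarrow> 'a) \<Rightarrow> bool" where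
  "distributed_pi_solution f E k\<^sub>P k\<^sub>I w \<xi> \<longleftrightarrow>
     (\<forall>i. \<forall>t\<ge>0.
        (w i has_vector_derivative
           (- gradient (f i) (w i t)
            + k\<^sub>P *\<^sub>R (\<Sum>j\<in>E `` {i}. w j t - w i t)
            + k\<^sub>I *\<^sub>R (\<Sum>j\<in>E `` {i}. \<xi> j t - \<xi> i t))) (at t within {0..}) \<and>
        (\<xi> i has_vector_derivative
           - (k\<^sub>I *\<^sub>R (\<Sum>j\<in>E `` {i}. w j t - w i t))) (at t within {0..}))"

end

theory Submission
  imports Defs
begin

text \<open>The stacked agent states are split into their mean \<open>m\<close> and the disagreement \<open>x\<close>, the part of mean zero.
  The Laplacian coupling cancels in the mean, so that \<open>m\<close> follows the centralized gradient flow
  \<open>m' = - \<nabla>F m\<close> up to an error bounded by a multiple of \<open>|x|\<close>. The disagreement and the integral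
  states, the latter measured from an equilibrium, form a linear system \<open>x' = - P A x - k A \<eta> + u\<close>,
  \<open>\<eta>' = k A x\<close> on the vectors of mean zero, where the graph Laplacian \<open>A\<close> has a spectral gap \<open>l\<close>. The energy
  \<open>V = |x|\<^sup>2 / 2 + |\<eta>|\<^sup>2 / 2 + (k / P) (x \<bullet> \<eta>)\<close> dissipates in both variables, at the rates \<open>l P\<close> in \<open>|x|\<^sup>2\<close> and
  \<open>l k\<^sup>2 / P\<close> in \<open>|\<eta>|\<^sup>2\<close> up to constants, and the forcing \<open>u\<close> costs only a prescribed multiple \<open>\<beta>\<close> of the
  squared distance of \<open>m\<close> from the minimizer once \<open>P\<close> is large (\<open>cross_energy_dissipation\<close>, \<open>energy_along_solution\<close>).

  For fixed \<open>k\<close> and large \<open>P\<close>, half the squared distance of \<open>m\<close> from the minimizer plus \<open>V\<close> is a strict Lyapunov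
  function, by strong convexity of \<open>F\<close> (\<open>convergence_of_fixed_gains\<close>).

  For \<open>P = k powr (3/2)\<close> both dissipation rates are at least of order \<open>sqrt k\<close>, so \<open>V\<close> is as fast as
  desired. Then \<open>m\<close> inherits the rate of the gradient flow (\<open>slow_fast_exponential\<close>): over a window of
  a fixed length \<open>T\<close> the path of \<open>m\<close> differs from the gradient flow with the same initial value by an
  arbitrarily small multiple of the initial data, and \<open>T\<close> is chosen so large that the flow contracts by
  more than \<open>exp (- (\<mu> - \<upsilon>) T)\<close>, its constant \<open>c\<close> included. Stability of the gradient flow is an
  assumption on its solutions, so the argument needs that these exist
  (\<open>lipschitz_solution_exists\<close>).\<close>

section \<open>Global solutions of Lipschitz differential equations\<close>

lemma integral_has_vector_derivative_from_zero:
  fixes q :: "real \<Rightarrow> 'a::banach"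
  assumes "continuous_on {0..} q" and "0 \<le> t"
  shows "((\<lambda>u. integral {0..u} q) has_vector_derivative q t) (at t within {0..})"
proof -
  have "((\<lambda>u. integral {0..u} q) has_vector_derivative q t) (at t within {0..t+1})"
    by (rule integral_has_vector_derivative)
      (use assms in \<open>auto intro: continuous_on_subset\<close>)
  moreover have "at t within {0..t+1} = at t within {0..}"
    by (rule at_within_nhd[of t "{..<t+1}"]) auto
  ultimately show ?thesis by simp
qed

lemma norm_integral_le_exp:
  fixes q :: "real \<Rightarrow> 'a::banach"
  assumes cont: "continuous_on {0..} q" and K: "0 < K" and t: "0 \<le> t" and c: "0 \<le> c"
    and le: "\<And>s. 0 \<le> s \<Longrightarrow> norm (q s) \<le> c * exp (K * s)"
  shows "norm (integral {0..t} q) \<le> c / K * exp (K * t)"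
proof -
  have exp_int: "((\<lambda>s. c * exp (K * s)) has_integral
      c / K * exp (K * t) - c / K * exp (K * 0)) {0..t}"
    by (rule fundamental_theorem_of_calculus[OF t])
      (use K in \<open>auto intro!: derivative_eq_intros simp flip: has_real_derivative_iff_has_vector_derivative\<close>)
  have "norm (integral {0..t} q) \<le> integral {0..t} (\<lambda>s. c * exp (K * s))"
  proof (rule integral_norm_bound_integral)
    show "q integrable_on {0..t}"
      by (rule integrable_continuous_real, rule continuous_on_subset[OF cont]) auto
  qed (use exp_int le in auto)
  also have "\<dots> = c / K * exp (K * t) - c / K"
    using integral_unique[OF exp_int] by simp
  also have "\<dots> \<le> c / K * exp (K * t)" using c K by simp
  finally show ?thesis .
qed

text \<open>In the norm \<open>sup\<^sub>t exp (- 2 K t) |p t - p 0|\<close> with \<open>K\<close> a Lipschitz constant, the integral operator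
  is a contraction by \<open>1/2\<close> on the whole half-line, so that one application of Banach's theorem
  gives the global solution and no local solutions have to be glued. The fixed point below is
  \<open>y t = exp (- 2 K t) (p t - p 0)\<close>, a bounded continuous function; negative times are
  mapped to \<open>0\<close> because the type of bounded continuous functions asks for a total function.\<close>

lemma lipschitz_solution_exists:
  fixes g :: "'a::euclidean_space \<Rightarrow> 'a"
  assumes "L-lipschitz_on UNIV g"
  shows "\<exists>p. p 0 = x0 \<and> solution_of g p"
proof -
  define K where "K = L + 1"
  have L0: "0 \<le> L" using lipschitz_on_nonneg[OF assms] .
  have K: "K > 0" using L0 by (simp add: K_def)
  have lip: "norm (g a - g b) \<le> K * norm (a - b)" for a b
  proof -
    have "norm (g a - g b) \<le> L * norm (a - b)"
      using lipschitz_onD[OF assms, of a b] by (simp add: dist_norm)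
    also have "\<dots> \<le> K * norm (a - b)" by (simp add: K_def mult_right_mono)
    finally show ?thesis .
  qed
  have cg: "continuous_on UNIV g" using lipschitz_on_continuous_on[OF assms] .
  define h :: "(real \<Rightarrow>\<^sub>C 'a) \<Rightarrow> real \<Rightarrow> 'a"
    where "h y s = g (x0 + exp (2*K * s) *\<^sub>R apply_bcontfun y s)" for y s
  have ch: "continuous_on S (h y)" for S y
    unfolding h_def
    by (rule continuous_on_compose2[OF cg]) (auto intro!: continuous_intros)
  define J where "J y t = integral {0..t} (h y)" for y t
  have dJ: "(J y has_vector_derivative h y t) (at t within {0..})" if "0 \<le> t" for y t
    unfolding J_def by (rule integral_has_vector_derivative_from_zero[OF ch that])
  have cJ: "continuous_on {0..} (J y)" for y
    by (rule continuous_on_vector_derivative[of _ _ "h y"]) (use dJ in auto)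
  define \<Phi> where "\<Phi> y t = exp (- (2*K) * max 0 t) *\<^sub>R J y (max 0 t)" for y t
  have \<Phi>b: "norm (\<Phi> y t) \<le> (norm (g x0) + K * dist y 0) / (2*K)" for y :: "real \<Rightarrow>\<^sub>C 'a" and t
  proof -
    let ?c = "norm (g x0) + K * dist y 0" and ?t = "max 0 t"
    have "norm (J y ?t) \<le> ?c / (2*K) * exp (2*K * ?t)"
      unfolding J_def
    proof (rule norm_integral_le_exp[OF ch])
      fix s :: real assume s: "0 \<le> s"
      have "norm (h y s) \<le> norm (g x0) + norm (h y s - g x0)" by (rule norm_triangle_sub)
      also have "norm (h y s - g x0) \<le> K * (exp (2*K * s) * norm (apply_bcontfun y s))"
        using lip[of "x0 + exp (2*K * s) *\<^sub>R apply_bcontfun y s" x0] by (simp add: h_def)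
      also have "\<dots> \<le> K * (exp (2*K * s) * dist y 0)"
        using dist_bounded[of y s 0] K by (intro mult_left_mono) auto
      also have "norm (g x0) \<le> norm (g x0) * exp (2*K * s)"
        using K s by (simp add: mult_le_cancel_left1)
      finally show "norm (h y s) \<le> ?c * exp (2*K * s)" by (simp add: algebra_simps)
    qed (use K in auto)
    then have "exp (- (2*K * ?t)) * norm (J y ?t) \<le> exp (- (2*K * ?t)) * (?c / (2*K) * exp (2*K * ?t))"
      by (rule mult_left_mono) simp
    also have "\<dots> = ?c / (2*K)" by (simp add: exp_minus)
    finally show ?thesis by (simp add: \<Phi>_def)
  qed
  have c\<Phi>: "continuous_on UNIV (\<Phi> y)" for y
    unfolding \<Phi>_def
    by (intro continuous_intros continuous_on_compose2[OF cJ]) auto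
  have \<Phi>in: "\<Phi> y \<in> bcontfun" for y
    using c\<Phi> \<Phi>b by (auto simp: bcontfun_def bounded_iff)
  define \<Psi> where "\<Psi> y = Bcontfun (\<Phi> y)" for y
  have \<Psi>: "apply_bcontfun (\<Psi> y) = \<Phi> y" for y
    unfolding \<Psi>_def by (rule Bcontfun_inverse[OF \<Phi>in])
  have contr: "dist (\<Psi> y) (\<Psi> z) \<le> 1/2 * dist y z" for y z
  proof (rule dist_bound)
    fix t :: real
    let ?t = "max 0 t"
    have "J y ?t - J z ?t = integral {0..?t} (\<lambda>s. h y s - h z s)"
      unfolding J_def
      by (rule integral_diff[symmetric]) (auto intro!: integrable_continuous_real ch)
    also have "norm \<dots> \<le> (K * dist y z) / (2*K) * exp (2*K * ?t)"
    proof (rule norm_integral_le_exp)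
      fix s :: real assume s: "0 \<le> s"
      have "norm (h y s - h z s) \<le> K * (exp (2*K * s) * norm (apply_bcontfun y s - apply_bcontfun z s))"
        using lip[of "x0 + exp (2*K * s) *\<^sub>R apply_bcontfun y s" "x0 + exp (2*K * s) *\<^sub>R apply_bcontfun z s"]
        by (simp add: h_def flip: scaleR_diff_right)
      also have "\<dots> \<le> K * (exp (2*K * s) * dist y z)"
        using dist_bounded[of y s z] K by (intro mult_left_mono) (auto simp: dist_norm)
      finally show "norm (h y s - h z s) \<le> K * dist y z * exp (2*K * s)" by (simp add: algebra_simps)
    qed (use K in \<open>auto intro!: continuous_on_diff ch\<close>)
    finally have "norm (J y ?t - J z ?t) \<le> dist y z / 2 * exp (2*K * ?t)" using K by simp
    then have "exp (- (2*K * ?t)) * norm (J y ?t - J z ?t)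
        \<le> exp (- (2*K * ?t)) * (dist y z / 2 * exp (2*K * ?t))"
      by (rule mult_left_mono) simp
    also have "\<dots> = 1/2 * dist y z" by (simp add: exp_minus)
    finally show "dist (apply_bcontfun (\<Psi> y) t) (apply_bcontfun (\<Psi> z) t) \<le> 1/2 * dist y z"
      by (simp add: \<Psi> \<Phi>_def dist_norm flip: scaleR_diff_right)
  qed
  obtain y where y: "\<Psi> y = y"
    using banach_fix_type[of "1/2" \<Psi>] contr by auto
  define p where "p t = x0 + J y t" for t
  have yJ: "exp (2*K*t) *\<^sub>R apply_bcontfun y t = J y t" if "0 \<le> t" for t
    using \<Psi>[of y] that unfolding y \<Phi>_def by (simp add: exp_minus)
  have "solution_of g p"
    unfolding solution_of_def
  proof (intro allI impI)
    fix t :: real assume t: "0 \<le> t"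
    have "h y t = g (p t)" by (simp add: h_def p_def yJ[OF t])
    then show "(p has_vector_derivative g (p t)) (at t within {0..})"
      unfolding p_def using dJ[OF t, of y] by (auto intro!: derivative_eq_intros)
  qed
  moreover have "p 0 = x0" by (simp add: p_def J_def)
  ultimately show ?thesis by blast
qed

section \<open>Consensus and disagreement\<close>

definition consensus :: "'a \<Rightarrow> 'a ^ 'v" where
  "consensus a = (\<chi> i. a)"

definition agent_mean :: "'a::real_vector ^ 'v::finite \<Rightarrow> 'a" where
  "agent_mean x = (\<Sum>i\<in>UNIV. x $ i) /\<^sub>R real CARD('v)"

definition disagreement :: "'a::real_vector ^ 'v::finite \<Rightarrow> 'a ^ 'v" where
  "disagreement x = x - consensus (agent_mean x)"

definition laplacian :: "('v \<times> 'v) set \<Rightarrow> 'a::real_vector ^ 'v::finite \<Rightarrow> 'a ^ 'v" where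
  "laplacian E x = (\<chi> i. \<Sum>j\<in>E `` {i}. x $ i - x $ j)"

lemma consensus_nth [simp]: "consensus a $ i = a"
  by (simp add: consensus_def)

lemma linear_consensus: "linear (consensus :: 'a::real_vector \<Rightarrow> 'a ^ 'v::finite)"
  by (rule linearI) (simp_all add: vec_eq_iff)

lemma linear_agent_mean: "linear (agent_mean :: 'a::real_vector ^ 'v::finite \<Rightarrow> 'a)"
  by (rule linearI)
    (simp_all add: agent_mean_def sum.distrib scaleR_right_distrib scaleR_right.sum mult.commute)

lemma linear_disagreement: "linear (disagreement :: 'a::real_vector ^ 'v::finite \<Rightarrow> 'a ^ 'v)"
  unfolding disagreement_def
  using linear_compose_sub[OF linear_id[unfolded id_def] linear_compose[OF linear_agent_mean linear_consensus]]
  by (simp add: o_def)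

lemma linear_laplacian: "linear (laplacian E :: 'a::real_vector ^ 'v::finite \<Rightarrow> 'a ^ 'v)"
  by (rule linearI)
    (simp_all add: laplacian_def vec_eq_iff scaleR_right.sum scaleR_diff_right sum_subtractf sum.distrib
      algebra_simps)

lemma agent_mean_consensus [simp]: "agent_mean (consensus a :: 'a::real_vector ^ 'v::finite) = a"
  by (simp add: agent_mean_def scaleR_left.sum sum_constant_scaleR)

lemma agent_mean_disagreement [simp]: "agent_mean (disagreement x) = 0"
  by (simp add: disagreement_def linear_diff[OF linear_agent_mean])

lemma disagreement_eq_self: "agent_mean x = 0 \<Longrightarrow> disagreement x = x"
  by (simp add: disagreement_def linear_0[OF linear_consensus])

lemma inner_consensus_left:
  "consensus a \<bullet> x = real CARD('v) * (a \<bullet> agent_mean x)"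
  for x :: "'a::euclidean_space ^ 'v::finite"
  by (simp add: inner_vec_def agent_mean_def flip: inner_sum_right)

lemma norm_sq_mean_disagreement:
  "(norm x)\<^sup>2 = real CARD('v) * (norm (agent_mean x))\<^sup>2 + (norm (disagreement x))\<^sup>2"
  for x :: "'a::euclidean_space ^ 'v::finite"
proof -
  have "(norm x)\<^sup>2 = (norm (consensus (agent_mean x) + disagreement x))\<^sup>2"
    by (simp add: disagreement_def)
  also have "\<dots> = consensus (agent_mean x) \<bullet> (consensus (agent_mean x) :: 'a ^ 'v)
      + 2 * (consensus (agent_mean x) \<bullet> disagreement x) + disagreement x \<bullet> disagreement x"
    by (simp add: power2_norm_eq_inner inner_add_left inner_add_right inner_commute)
  finally show ?thesis
    by (simp add: inner_consensus_left power2_norm_eq_inner)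
qed

lemma norm_agent_mean_le: "norm (agent_mean x) \<le> norm x"
  for x :: "'a::euclidean_space ^ 'v::finite"
proof -
  have "1 * (norm (agent_mean x))\<^sup>2 \<le> real CARD('v) * (norm (agent_mean x))\<^sup>2"
    by (rule mult_right_mono) (simp_all add: Suc_le_eq)
  also have "\<dots> \<le> (norm x)\<^sup>2" using norm_sq_mean_disagreement[of x] by simp
  finally have "(norm (agent_mean x))\<^sup>2 \<le> (norm x)\<^sup>2" by simp
  then show ?thesis by (rule power2_le_imp_le) simp
qed

lemma norm_disagreement_le: "norm (disagreement x) \<le> norm x"
  for x :: "'a::euclidean_space ^ 'v::finite"
proof (rule power2_le_imp_le)
  show "(norm (disagreement x))\<^sup>2 \<le> (norm x)\<^sup>2"
    using norm_sq_mean_disagreement[of x] by simp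
qed simp

lemma norm_consensus_le: "norm (consensus a :: 'a::real_normed_vector ^ 'v::finite) \<le> real CARD('v) * norm a"
  unfolding norm_vec_def
  by (rule order_trans[OF L2_set_le_sum]) auto

section \<open>The graph Laplacian\<close>

text \<open>Each edge occurs in \<open>E\<close> as two arcs, hence the factor \<open>2\<close>.\<close>

lemma two_inner_laplacian:
  fixes x y :: "'a::euclidean_space ^ 'v::finite"
  assumes "sym E"
  shows "2 * (x \<bullet> laplacian E y) = (\<Sum>(i, j)\<in>E. (x $ i - x $ j) \<bullet> (y $ i - y $ j))"
proof -
  have E: "E = (SIGMA i:UNIV. E `` {i})" by auto
  have *: "x \<bullet> laplacian E y = (\<Sum>(i, j)\<in>E. x $ i \<bullet> (y $ i - y $ j))"
    by (subst (2) E) (simp add: inner_vec_def laplacian_def inner_sum_right sum.Sigma)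
  also have "\<dots> = (\<Sum>(i, j)\<in>E. x $ j \<bullet> (y $ j - y $ i))"
    by (rule sum.reindex_bij_witness[of _ prod.swap prod.swap])
      (auto dest: symD[OF assms])
  finally have "x \<bullet> laplacian E y = (\<Sum>(i, j)\<in>E. x $ j \<bullet> (y $ j - y $ i))" .
  then have "2 * (x \<bullet> laplacian E y)
      = (\<Sum>(i, j)\<in>E. x $ i \<bullet> (y $ i - y $ j)) + (\<Sum>(i, j)\<in>E. x $ j \<bullet> (y $ j - y $ i))"
    using * by simp
  also have "\<dots> = (\<Sum>(i, j)\<in>E. (x $ i - x $ j) \<bullet> (y $ i - y $ j))"
    unfolding sum.distrib[symmetric] by (rule sum.cong) (auto simp: inner_simps)
  finally show ?thesis .
qed

lemma laplacian_self_adjoint: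
  fixes x y :: "'a::euclidean_space ^ 'v::finite"
  assumes "sym E"
  shows "laplacian E x \<bullet> y = x \<bullet> laplacian E y"
  using two_inner_laplacian[OF assms, of x y] two_inner_laplacian[OF assms, of y x]
  by (simp add: inner_commute)

lemma laplacian_consensus [simp]: "laplacian E (consensus a :: 'a::real_vector ^ 'v::finite) = 0"
  by (simp add: laplacian_def vec_eq_iff)

lemma laplacian_disagreement [simp]: "laplacian E (disagreement x) = laplacian E x"
  by (simp add: disagreement_def linear_diff[OF linear_laplacian])

lemma agent_mean_laplacian [simp]:
  fixes x :: "'a::euclidean_space ^ 'v::finite"
  assumes "sym E"
  shows "agent_mean (laplacian E x) = 0"
proof -
  have "real CARD('v) * (agent_mean (laplacian E x) \<bullet> agent_mean (laplacian E x)) = 0"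
    using laplacian_self_adjoint[OF assms, of "consensus (agent_mean (laplacian E x))" x]
    by (simp flip: inner_consensus_left)
  then show ?thesis by simp
qed

lemma laplacian_nonneg:
  fixes x :: "'a::euclidean_space ^ 'v::finite"
  assumes "sym E"
  shows "0 \<le> x \<bullet> laplacian E x"
proof -
  have "0 \<le> (\<Sum>(i, j)\<in>E. (x $ i - x $ j) \<bullet> (x $ i - x $ j))"
    by (rule sum_nonneg) auto
  then show ?thesis using two_inner_laplacian[OF assms, of x x] by simp
qed

text \<open>The form is a sum of squares over the edges, so its zeros are constant along paths.\<close>

lemma laplacian_form_zero_imp_consensus:
  fixes x :: "'a::euclidean_space ^ 'v::finite"
  assumes "connected_undirected_graph E" and zero: "x \<bullet> laplacian E x = 0"
  shows "x = consensus (agent_mean x)"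
proof -
  have "sym E" and conn: "\<And>i j. (i, j) \<in> E\<^sup>*"
    using assms(1) by (auto simp: connected_undirected_graph_def)
  have "(\<Sum>(i, j)\<in>E. (x $ i - x $ j) \<bullet> (x $ i - x $ j)) = 0"
    using two_inner_laplacian[OF \<open>sym E\<close>, of x x] zero by simp
  then have edge: "x $ i = x $ j" if "(i, j) \<in> E" for i j
    using that by (subst (asm) sum_nonneg_eq_0_iff) auto
  have eq: "x $ i = x $ j" for i j
    using conn[of i j] by (induction rule: rtrancl_induct) (auto dest: edge)
  have "x = consensus (x $ undefined)"
    using eq by (simp add: vec_eq_iff)
  then show ?thesis by (metis agent_mean_consensus)
qed

text \<open>Adding the projection onto the consensus subspace to the Laplacian makes its quadratic form
  positive definite on the whole space. One compactness argument on the unit sphere and one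
  dimension count for that operator then yield both the spectral gap and the solvability of
  \<open>laplacian E z = y\<close> for \<open>y\<close> of mean zero.\<close>

lemma laplacian_plus_mean_pos:
  fixes x :: "'a::euclidean_space ^ 'v::finite"
  assumes "connected_undirected_graph E" and "x \<noteq> 0"
  shows "0 < x \<bullet> (laplacian E x + consensus (agent_mean x))"
proof -
  have "sym E" using assms(1) by (auto simp: connected_undirected_graph_def)
  have eq: "x \<bullet> (laplacian E x + consensus (agent_mean x))
      = x \<bullet> laplacian E x + real CARD('v) * (norm (agent_mean x))\<^sup>2"
    using inner_consensus_left[of "agent_mean x" x]
    by (simp add: inner_add_right inner_commute power2_norm_eq_inner)
  have "x \<bullet> laplacian E x \<noteq> 0 \<or> agent_mean x \<noteq> 0"
    using laplacian_form_zero_imp_consensus[OF assms(1), of x] assms(2)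
    by (auto simp: linear_0[OF linear_consensus])
  then show ?thesis
    unfolding eq using laplacian_nonneg[OF \<open>sym E\<close>, of x]
    by (auto simp: add_pos_nonneg add_nonneg_pos)
qed

lemma laplacian_spectral_gap:
  assumes "connected_undirected_graph (E :: ('v::finite \<times> 'v) set)"
  shows "\<exists>l>0. \<forall>x::'a::euclidean_space ^ 'v. agent_mean x = 0 \<longrightarrow> l * (norm x)\<^sup>2 \<le> x \<bullet> laplacian E x"
proof -
  define M where "M x = laplacian E x + consensus (agent_mean x)" for x :: "'a ^ 'v"
  have linM: "linear M"
    unfolding M_def
    by (intro linear_compose_add linear_laplacian
        linear_compose[OF linear_agent_mean linear_consensus, unfolded o_def])
  have "continuous_on (sphere 0 1) (\<lambda>x. x \<bullet> M x)"
    using linear_continuous_on[OF linear_conv_bounded_linear[THEN iffD1, OF linM]]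
    by (intro continuous_intros)
  moreover have "(sphere 0 1 :: ('a ^ 'v) set) \<noteq> {}" by simp
  ultimately obtain u where u: "u \<in> sphere 0 1" and
    le: "\<And>x. x \<in> sphere 0 1 \<Longrightarrow> u \<bullet> M u \<le> x \<bullet> M x"
    using continuous_attains_inf[OF compact_sphere, of 0 1 "\<lambda>x. x \<bullet> M x"] by blast
  have "u \<noteq> 0" using u by auto
  then have pos: "0 < u \<bullet> M u"
    using laplacian_plus_mean_pos[OF assms] by (simp add: M_def)
  have "(u \<bullet> M u) * (norm x)\<^sup>2 \<le> x \<bullet> laplacian E x" if "agent_mean x = 0" for x :: "'a ^ 'v"
  proof (cases "x = 0")
    case False
    have "u \<bullet> M u \<le> (x /\<^sub>R norm x) \<bullet> M (x /\<^sub>R norm x)"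
      using le[of "x /\<^sub>R norm x"] False by simp
    also have "\<dots> = (x \<bullet> M x) / (norm x)\<^sup>2"
      by (simp add: linear_scale[OF linM] power2_eq_square divide_inverse)
    finally have "(u \<bullet> M u) * (norm x)\<^sup>2 \<le> x \<bullet> M x"
      using False by (simp add: field_simps)
    then show ?thesis using that by (simp add: M_def linear_0[OF linear_consensus])
  qed simp
  then show ?thesis using pos by blast
qed

lemma laplacian_solvable:
  fixes y :: "'a::euclidean_space ^ 'v::finite"
  assumes "connected_undirected_graph E" and "agent_mean y = 0"
  shows "\<exists>z. agent_mean z = 0 \<and> laplacian E z = y"
proof -
  define M where "M x = laplacian E x + consensus (agent_mean x)" for x :: "'a ^ 'v"
  have linM: "linear M"
    unfolding M_def
    by (intro linear_compose_add linear_laplacian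
        linear_compose[OF linear_agent_mean linear_consensus, unfolded o_def])
  have "inj M"
  proof (subst linear_injective_0[OF linM], intro allI impI)
    fix x assume "M x = 0"
    then show "x = 0"
      using laplacian_plus_mean_pos[OF assms(1), of x] by (auto simp: M_def)
  qed
  then have "surj M" using linear_injective_imp_surjective[OF linM] by simp
  then obtain z where z: "M z = y" by (metis surjD)
  have "sym E" using assms(1) by (auto simp: connected_undirected_graph_def)
  have "agent_mean (M z) = agent_mean z"
    by (simp add: M_def linear_add[OF linear_agent_mean] \<open>sym E\<close>)
  then have "agent_mean z = 0" using z assms(2) by simp
  then show ?thesis using z by (auto simp: M_def linear_0[OF linear_consensus])
qed

text \<open>This is the nonnegativity of the quadratic form at \<open>s *\<^sub>R x + y\<close>.\<close>

lemma laplacian_form_young: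
  fixes x y :: "'a::euclidean_space ^ 'v::finite"
  assumes "sym E" and "0 < s"
  shows "- (x \<bullet> laplacian E y) \<le> s / 2 * (x \<bullet> laplacian E x) + 1 / (2 * s) * (y \<bullet> laplacian E y)"
proof -
  have yx: "y \<bullet> laplacian E x = x \<bullet> laplacian E y"
    using laplacian_self_adjoint[OF assms(1), of x y] by (simp add: inner_commute)
  have "0 \<le> (s *\<^sub>R x + y) \<bullet> laplacian E (s *\<^sub>R x + y)"
    by (rule laplacian_nonneg[OF assms(1)])
  also have "\<dots> = s\<^sup>2 * (x \<bullet> laplacian E x) + 2 * s * (x \<bullet> laplacian E y) + y \<bullet> laplacian E y"
    by (simp add: linear_add[OF linear_laplacian] linear_scale[OF linear_laplacian]
        inner_add_left inner_add_right yx power2_eq_square algebra_simps)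
  finally show ?thesis using assms(2) by (simp add: field_simps power2_eq_square)
qed

section \<open>Differential inequalities\<close>

lemma has_real_derivative_inner:
  assumes "(p has_vector_derivative p') (at t within S)" and "(q has_vector_derivative q') (at t within S)"
  shows "((\<lambda>t. p t \<bullet> q t) has_real_derivative (p t \<bullet> q' + p' \<bullet> q t)) (at t within S)"
  using bounded_bilinear.has_vector_derivative[OF bounded_bilinear_inner assms]
  by (simp add: has_real_derivative_iff_has_vector_derivative)

lemma has_vector_derivative_shift:
  assumes "(p has_vector_derivative p') (at (s + t) within {0..})" and "0 \<le> s"
  shows "((\<lambda>u. p (s + u)) has_vector_derivative p') (at t within {0..})"
proof -
  have "((\<lambda>u::real. s + u) has_vector_derivative 1) (at t within {0..})"
    by (auto intro!: derivative_eq_intros)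
  moreover have "(p has_vector_derivative p') (at (s + t) within (\<lambda>u. s + u) ` {0..})"
    by (rule has_vector_derivative_within_subset[OF assms(1)]) (use assms(2) in auto)
  ultimately show ?thesis
    using vector_diff_chain_within[of "\<lambda>u. s + u" 1 t "{0..}" p p'] by (simp add: o_def)
qed

lemma young_inner:
  fixes a b :: "'a::real_inner"
  assumes "0 < s"
  shows "2 * (a \<bullet> b) \<le> s * (norm a)\<^sup>2 + (norm b)\<^sup>2 / s"
proof -
  have "0 \<le> (s *\<^sub>R a - b) \<bullet> (s *\<^sub>R a - b)" by simp
  also have "\<dots> = s\<^sup>2 * (norm a)\<^sup>2 - 2 * s * (a \<bullet> b) + (norm b)\<^sup>2"
    by (simp add: inner_diff_left inner_diff_right inner_commute power2_norm_eq_inner)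
      (simp add: power2_eq_square)
  finally show ?thesis using assms by (simp add: field_simps power2_eq_square)
qed

lemma norm_sq_add_le: "(norm (a + b))\<^sup>2 \<le> 2 * (norm a)\<^sup>2 + 2 * (norm b)\<^sup>2"
  for a b :: "'a::real_inner"
  using young_inner[of 1 a b]
  by (simp add: power2_norm_eq_inner inner_add_left inner_add_right inner_commute)

lemma le_linear_of_derivative_le:
  fixes h :: "real \<Rightarrow> real"
  assumes deriv: "\<And>t. 0 \<le> t \<Longrightarrow> (h has_real_derivative h' t) (at t within {0..})"
    and le: "\<And>t. 0 \<le> t \<Longrightarrow> t \<le> T \<Longrightarrow> h' t \<le> c"
    and t: "0 \<le> t" "t \<le> T"
  shows "h t \<le> h 0 + c * t"
proof -
  have d: "((\<lambda>s. h s - c * s) has_real_derivative h' s - c) (at s within {0..})" if "0 \<le> s" for s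
    using deriv[OF that] by (auto intro!: derivative_eq_intros)
  have "(\<lambda>s. h s - c * s) t \<le> (\<lambda>s. h s - c * s) 0"
  proof (rule DERIV_nonpos_imp_decreasing_open[where f = "\<lambda>s. h s - c * s"])
    fix s :: real assume s: "0 < s" "s < t"
    then have "at s within {0..} = at s" by (intro at_within_interior) auto
    with d[of s] le[of s] s t show "\<exists>y. ((\<lambda>s. h s - c * s) has_real_derivative y) (at s) \<and> y \<le> 0"
      by (intro exI[of _ "h' s - c"]) auto
  next
    have "continuous_on {0..} (\<lambda>s. h s - c * s)"
      by (rule DERIV_continuous_on[OF d]) auto
    then show "continuous_on {0..t} (\<lambda>s. h s - c * s)" by (rule continuous_on_subset) auto
  qed (use t in auto)
  then show ?thesis by simp
qed

lemma exponential_decay_of_derivative_le: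
  fixes h :: "real \<Rightarrow> real"
  assumes deriv: "\<And>t. 0 \<le> t \<Longrightarrow> (h has_real_derivative h' t) (at t within {0..})"
    and le: "\<And>t. 0 \<le> t \<Longrightarrow> t \<le> T \<Longrightarrow> h' t \<le> - R * h t + c"
    and t: "0 \<le> t" "t \<le> T" and R: "0 < R" and c: "0 \<le> c"
  shows "h t \<le> exp (- R * t) * h 0 + c / R"
proof -
  define q where "q s = exp (R * s) * (h s - c / R)" for s
  define q' where "q' s = exp (R * s) * (R * h s - c + h' s)" for s
  have "q t \<le> q 0 + 0 * t"
  proof (rule le_linear_of_derivative_le[where T = T and h' = q'])
    show "(q has_real_derivative q' s) (at s within {0..})" if "0 \<le> s" for s
      unfolding q_def q'_def using deriv[OF that] R
      by (auto intro!: derivative_eq_intros simp: field_simps)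
    show "q' s \<le> 0" if "0 \<le> s" "s \<le> T" for s
      unfolding q'_def using le[OF that] by (intro mult_nonneg_nonpos) auto
  qed (use t in auto)
  then have "exp (- R * t) * q t \<le> exp (- R * t) * (h 0 - c / R)"
    by (intro mult_left_mono) (auto simp: q_def)
  moreover have "exp (- R * t) * q t = h t - c / R"
    by (simp add: q_def mult.assoc[symmetric] flip: exp_add)
  moreover have "exp (- R * t) * (h 0 - c / R) \<le> exp (- R * t) * h 0"
    using R c by (intro mult_left_mono) auto
  ultimately show ?thesis by linarith
qed

lemma exponential_decay_of_window_contraction:
  fixes Y :: "real \<Rightarrow> real"
  assumes T: "0 < T" and K: "0 \<le> K" and r: "0 \<le> r"
    and Y0: "\<And>s. 0 \<le> s \<Longrightarrow> 0 \<le> Y s"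
    and contr: "\<And>s. 0 \<le> s \<Longrightarrow> Y (s + T) \<le> exp (- r * T) * Y s"
    and grow: "\<And>s u. 0 \<le> s \<Longrightarrow> 0 \<le> u \<Longrightarrow> u \<le> T \<Longrightarrow> Y (s + u) \<le> K * Y s"
    and t: "0 \<le> t"
  shows "Y t \<le> K * exp (r * T) * Y 0 * exp (- r * t)"
proof -
  have nth: "Y (real n * T) \<le> exp (- r * (real n * T)) * Y 0" for n
  proof (induction n)
    case (Suc n)
    have "Y (real (Suc n) * T) \<le> exp (- r * T) * Y (real n * T)"
      using contr[of "real n * T"] T by (simp add: algebra_simps)
    also have "\<dots> \<le> exp (- r * T) * (exp (- r * (real n * T)) * Y 0)"
      by (intro mult_left_mono Suc) simp
    also have "\<dots> = exp (- r * (real (Suc n) * T)) * Y 0"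
      by (simp add: algebra_simps flip: exp_add)
    finally show ?case .
  qed simp
  define n where "n = nat \<lfloor>t / T\<rfloor>"
  have n: "real n * T \<le> t" "t < real n * T + T"
  proof -
    have "real n = of_int \<lfloor>t / T\<rfloor>" using t T by (simp add: n_def)
    then have "real n \<le> t / T" "t / T < real n + 1" by linarith+
    then show "real n * T \<le> t" "t < real n * T + T" using T by (simp_all add: field_simps)
  qed
  have "Y t \<le> K * Y (real n * T)"
    using grow[of "real n * T" "t - real n * T"] n T by simp
  also have "\<dots> \<le> K * (exp (- r * (real n * T)) * Y 0)"
    by (intro mult_left_mono nth K)
  also have "\<dots> \<le> K * ((exp (r * T) * exp (- r * t)) * Y 0)"
  proof (intro mult_left_mono mult_right_mono K)
    have "r * t \<le> r * (real n * T + T)" using n r by (intro mult_left_mono) auto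
    then show "exp (- r * (real n * T)) \<le> exp (r * T) * exp (- r * t)"
      by (simp add: algebra_simps flip: exp_add)
  qed (simp add: Y0)
  finally show ?thesis by (simp add: algebra_simps)
qed

section \<open>A slow flow perturbed by a fast variable\<close>

text \<open>The slow variable \<open>m\<close> follows the flow of \<open>- g\<close> up to an error controlled by the energy \<open>V\<close> of a fast
  variable; that energy decays at the rate \<open>R\<close> but is driven by the distance of \<open>m\<close> from \<open>q\<close>.\<close>

definition slow_fast_pair ::
  "('a::euclidean_space \<Rightarrow> 'a) \<Rightarrow> 'a \<Rightarrow> real \<Rightarrow> real \<Rightarrow> real \<Rightarrow> (real \<Rightarrow> 'a) \<Rightarrow> (real \<Rightarrow> real) \<Rightarrow> bool" where
  "slow_fast_pair g q a b R m V \<longleftrightarrow>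
     (\<exists>d V'. \<forall>t\<ge>0. (m has_vector_derivative - g (m t) + d t) (at t within {0..}) \<and>
        (V has_real_derivative V' t) (at t within {0..}) \<and>
        0 \<le> V t \<and> (norm (d t))\<^sup>2 \<le> a * V t \<and>
        V' t \<le> - R * V t + b * (norm (m t - q))\<^sup>2)"

lemma slow_fast_pair_shift:
  assumes "slow_fast_pair g q a b R m V" and "0 \<le> s"
  shows "slow_fast_pair g q a b R (\<lambda>t. m (s + t)) (\<lambda>t. V (s + t))"
proof -
  obtain d V' where *: "\<forall>t\<ge>0. (m has_vector_derivative - g (m t) + d t) (at t within {0..}) \<and>
        (V has_real_derivative V' t) (at t within {0..}) \<and>
        0 \<le> V t \<and> (norm (d t))\<^sup>2 \<le> a * V t \<and> V' t \<le> - R * V t + b * (norm (m t - q))\<^sup>2"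
    using assms(1) unfolding slow_fast_pair_def by blast
  have "((\<lambda>u. m (s + u)) has_vector_derivative - g (m (s + t)) + d (s + t)) (at t within {0..})"
    "((\<lambda>u. V (s + u)) has_real_derivative V' (s + t)) (at t within {0..})" if "0 \<le> t" for t
    unfolding has_real_derivative_iff_has_vector_derivative
    using *[rule_format, of "s + t"] that assms(2)
    by (simp_all add: has_vector_derivative_shift has_real_derivative_iff_has_vector_derivative)
  then show ?thesis
    unfolding slow_fast_pair_def using *[rule_format, of "s + t" for t] assms(2)
    by (intro exI[of _ "\<lambda>t. d (s + t)"] exI[of _ "\<lambda>t. V' (s + t)"]) simp
qed

text \<open>Over one window, compare \<open>m\<close> with the unperturbed solution \<open>\<phi>\<close> from the same initial value.
  Monotonicity of \<open>g\<close> keeps the squared distance \<open>D\<close> from being amplified, and \<open>D + (A / R) V\<close> has a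
  derivative of order \<open>1 / R\<close>: the weight \<open>A / R\<close> makes the decay of \<open>V\<close> absorb the error that
  \<open>V\<close> causes in \<open>D\<close>.\<close>

lemma slow_fast_window:
  assumes mono: "\<And>x y. \<alpha> * (norm (x - y))\<^sup>2 \<le> (g x - g y) \<bullet> (x - y)" and \<alpha>: "0 < \<alpha>"
    and pair: "slow_fast_pair g q (\<alpha> * A) (B / 2) R m V"
    and \<phi>: "solution_of (\<lambda>x. - g x) \<phi>" "\<phi> 0 = m 0"
    and \<phi>_bound: "\<And>t. 0 \<le> t \<Longrightarrow> norm (\<phi> t - q) \<le> c * norm (m 0 - q)"
    and R: "0 < R" and A: "0 \<le> A" and B: "0 \<le> B"
    and small: "A * B / R \<le> \<alpha>" "A / R \<le> \<delta>" "A * B * c\<^sup>2 * T / R \<le> \<delta>" "B * (\<delta> + c\<^sup>2) / R \<le> \<delta> / 2"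
    and t: "0 \<le> t" "t \<le> T"
  shows "(norm (m t - \<phi> t))\<^sup>2 \<le> \<delta> * ((norm (m 0 - q))\<^sup>2 + V 0)" (is "?D t \<le> _ * ?Y")
    and "V t \<le> exp (- R * t) * V 0 + \<delta> / 2 * ((norm (m 0 - q))\<^sup>2 + V 0)"
proof -
  let ?S = "(norm (m 0 - q))\<^sup>2"
  obtain d V' where
    dm: "\<And>t. 0 \<le> t \<Longrightarrow> (m has_vector_derivative - g (m t) + d t) (at t within {0..})" and
    dV: "\<And>t. 0 \<le> t \<Longrightarrow> (V has_real_derivative V' t) (at t within {0..})" and
    V: "\<And>t. 0 \<le> t \<Longrightarrow> 0 \<le> V t" and
    d: "\<And>t. 0 \<le> t \<Longrightarrow> (norm (d t))\<^sup>2 \<le> \<alpha> * A * V t" and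
    V'0: "\<And>t. 0 \<le> t \<Longrightarrow> V' t \<le> - R * V t + B / 2 * (norm (m t - q))\<^sup>2"
    using pair unfolding slow_fast_pair_def by blast
  have d\<phi>: "(\<phi> has_vector_derivative - g (\<phi> t)) (at t within {0..})" if "0 \<le> t" for t
    using \<phi>(1) that by (simp add: solution_of_def)
  have \<phi>q: "(norm (\<phi> t - q))\<^sup>2 \<le> c\<^sup>2 * ?S" if "0 \<le> t" for t
    using power_mono[OF \<phi>_bound[OF that], of 2] by (simp add: power_mult_distrib)
  have V': "V' t \<le> - R * V t + B * (?D t + c\<^sup>2 * ?S)" if "0 \<le> t" for t
  proof -
    have "(norm (m t - q))\<^sup>2 \<le> 2 * ?D t + 2 * (norm (\<phi> t - q))\<^sup>2"
      using norm_sq_add_le[of "m t - \<phi> t" "\<phi> t - q"] by simp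
    then have "(norm (m t - q))\<^sup>2 \<le> 2 * (?D t + c\<^sup>2 * ?S)" using \<phi>q[OF that] by simp
    then have "B / 2 * (norm (m t - q))\<^sup>2 \<le> B / 2 * (2 * (?D t + c\<^sup>2 * ?S))"
      using B by (intro mult_left_mono) auto
    then show ?thesis using V'0[OF that] by (simp add: distrib_left)
  qed
  define D' where "D' t = 2 * ((m t - \<phi> t) \<bullet> (- g (m t) + d t - - g (\<phi> t)))" for t
  have dD: "(?D has_real_derivative D' t) (at t within {0..})" if "0 \<le> t" for t
    using has_real_derivative_inner[OF has_vector_derivative_diff[OF dm[OF that] d\<phi>[OF that]]
        has_vector_derivative_diff[OF dm[OF that] d\<phi>[OF that]]]
    by (simp add: D'_def power2_norm_eq_inner inner_commute)
  have D': "D' t \<le> - \<alpha> * ?D t + A * V t" if "0 \<le> t" for t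
  proof -
    have "D' t = - 2 * ((g (m t) - g (\<phi> t)) \<bullet> (m t - \<phi> t)) + 2 * ((m t - \<phi> t) \<bullet> d t)"
      by (simp add: D'_def inner_simps inner_commute)
    moreover have "2 * ((m t - \<phi> t) \<bullet> d t) \<le> \<alpha> * ?D t + (norm (d t))\<^sup>2 / \<alpha>"
      by (rule young_inner[OF \<alpha>])
    moreover have "(norm (d t))\<^sup>2 / \<alpha> \<le> A * V t"
      using d[OF that] \<alpha> by (simp add: field_simps)
    ultimately show ?thesis using mono[of "m t" "\<phi> t"] by simp
  qed
  have D: "?D t \<le> \<delta> * ?Y" if t: "0 \<le> t" "t \<le> T" for t
  proof -
    define W where "W t = ?D t + A / R * V t" for t
    have "W t \<le> W 0 + (A * B / R * (c\<^sup>2 * ?S)) * t"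
    proof (rule le_linear_of_derivative_le[where T = T and h' = "\<lambda>t. D' t + A / R * V' t"])
      fix s :: real assume s: "0 \<le> s"
      show "(W has_real_derivative D' s + A / R * V' s) (at s within {0..})"
        unfolding W_def by (intro DERIV_add dD DERIV_cmult dV s)
      have "A / R * V' s \<le> A / R * (- R * V s + B * (?D s + c\<^sup>2 * ?S))"
        using A R by (intro mult_left_mono V' s) simp
      also have "\<dots> = - (A * V s) + A * B / R * ?D s + A * B / R * (c\<^sup>2 * ?S)"
        using R by (simp add: field_simps)
      also have "\<dots> \<le> - (A * V s) + \<alpha> * ?D s + A * B / R * (c\<^sup>2 * ?S)"
        using mult_right_mono[OF small(1), of "?D s"] by simp
      finally show "D' s + A / R * V' s \<le> A * B / R * (c\<^sup>2 * ?S)"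
        using D'[OF s] by simp
    qed (use t in auto)
    also have "\<dots> \<le> W 0 + (A * B / R * (c\<^sup>2 * ?S)) * T"
      using t A B R by (intro add_left_mono mult_left_mono) auto
    also have "\<dots> = A / R * V 0 + (A * B * c\<^sup>2 * T / R) * ?S"
      using \<phi>(2) by (simp add: W_def)
    also have "\<dots> \<le> \<delta> * V 0 + \<delta> * ?S"
      using V[of 0] by (intro add_mono mult_right_mono small) auto
    finally have "W t \<le> \<delta> * ?Y" by (simp add: algebra_simps)
    moreover have "?D t \<le> W t" using A R V[OF t(1)] by (simp add: W_def)
    ultimately show ?thesis by linarith
  qed
  show "?D t \<le> \<delta> * ?Y" by (rule D[OF t])
  have Y: "0 \<le> ?Y" using V[of 0] by simp
  have \<delta>: "0 \<le> \<delta>" using small(2) A R by (meson divide_nonneg_pos order_trans)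
  have "V t \<le> exp (- R * t) * V 0 + (B * ((\<delta> + c\<^sup>2) * ?Y)) / R"
  proof (rule exponential_decay_of_derivative_le[OF dV])
    fix s :: real assume s: "0 \<le> s" "s \<le> T"
    have "c\<^sup>2 * ?S \<le> c\<^sup>2 * ?Y" using V[of 0] by (intro mult_left_mono) auto
    with D[OF s] have "?D s + c\<^sup>2 * ?S \<le> (\<delta> + c\<^sup>2) * ?Y" by (simp add: algebra_simps)
    then show "V' s \<le> - R * V s + B * ((\<delta> + c\<^sup>2) * ?Y)"
      using V'[OF s(1)] mult_left_mono[OF _ B] by fastforce
  qed (use t R B Y \<delta> in auto)
  also have "(B * ((\<delta> + c\<^sup>2) * ?Y)) / R = (B * (\<delta> + c\<^sup>2) / R) * ?Y" by simp
  also have "\<dots> \<le> \<delta> / 2 * ?Y" by (rule mult_right_mono[OF small(4) Y])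
  finally show "V t \<le> exp (- R * t) * V 0 + \<delta> / 2 * ?Y" by simp
qed

lemma eventually_divide_le:
  fixes X e :: real
  assumes "0 < e"
  shows "\<forall>\<^sub>F R in at_top. X / R \<le> e"
proof -
  have "((\<lambda>R. X / R) \<longlongrightarrow> 0) at_top"
    by (intro tendsto_divide_0[OF tendsto_const] filterlim_at_top_imp_at_infinity filterlim_ident)
  from order_tendstoD(2)[OF this assms] show ?thesis by eventually_elim simp
qed

lemma eventually_exp_neg_le:
  fixes k e :: real
  assumes "0 < k" and "0 < e"
  shows "\<forall>\<^sub>F R in at_top. exp (- R * k) \<le> e"
proof -
  have "\<forall>\<^sub>F R in at_top. - ln e / k \<le> R" by (rule eventually_ge_at_top)
  then show ?thesis
  proof eventually_elim
    case (elim R)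
    then have "- R * k \<le> ln e" using assms(1) by (simp add: field_simps)
    then show ?case using assms(2) by (simp add: ln_ge_iff)
  qed
qed

text \<open>If every solution of \<open>p' = - g p\<close> converges at the rate \<open>\<mu>\<close>, then so does \<open>m\<close> at any smaller
  rate \<open>r\<close> once the fast variable is fast enough. On a window of a length \<open>T\<close> so large that the gain of
  \<open>\<mu>\<close> over \<open>r\<close> outweighs the constant \<open>c\<close>, the perturbation is negligible for large \<open>R\<close>; restarting the
  comparison flow at the end of each window keeps the error from accumulating.\<close>

lemma slow_fast_exponential:
  assumes lip: "L-lipschitz_on UNIV g"
    and mono: "\<And>x y. \<alpha> * (norm (x - y))\<^sup>2 \<le> (g x - g y) \<bullet> (x - y)" and \<alpha>: "0 < \<alpha>"
    and stable: "globally_exponentially_stable (\<lambda>x. - g x) q \<mu>"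
    and r: "0 < r" "r < \<mu>" and a: "0 \<le> a" and b: "0 \<le> b"
  shows "\<forall>\<^sub>F R in at_top. \<forall>m V. slow_fast_pair g q a b R m V \<longrightarrow>
    (\<exists>K. \<forall>t\<ge>0. (norm (m t - q))\<^sup>2 + V t \<le> K * exp (- (2 * r) * t))"
proof -
  obtain c0 where c0: "\<And>p t. solution_of (\<lambda>x. - g x) p \<Longrightarrow> 0 \<le> t \<Longrightarrow>
      norm (p t - q) \<le> c0 * exp (- \<mu> * t) * norm (p 0 - q)"
    using stable unfolding globally_exponentially_stable_def by blast
  define c where "c = max c0 1"
  have c: "norm (p t - q) \<le> c * exp (- \<mu> * t) * norm (p 0 - q)"
    if "solution_of (\<lambda>x. - g x) p" "0 \<le> t" for p t
  proof -
    have "c0 * exp (- \<mu> * t) * norm (p 0 - q) \<le> c * exp (- \<mu> * t) * norm (p 0 - q)"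
      by (intro mult_right_mono) (auto simp: c_def)
    then show ?thesis using c0[OF that] by linarith
  qed
  have c1: "1 \<le> c" by (simp add: c_def)
  (* The condition on T amounts to 2 c^2 exp (-2 \<mu> T) <= exp (-2 r T) / 2. The other half of the
     contraction factor is left for the perturbation: 2 \<delta> from m, \<delta>/2 + \<delta>/2 from V, in total 3 \<delta>. *)
  obtain T where T: "0 < T" "exp (- T * (2 * (\<mu> - r))) \<le> 1 / (4 * c\<^sup>2)"
  proof -
    have "\<forall>\<^sub>F T in at_top. 0 < T \<and> exp (- T * (2 * (\<mu> - r))) \<le> 1 / (4 * c\<^sup>2)"
      using r c1 by (intro eventually_conj eventually_gt_at_top eventually_exp_neg_le) auto
    then show ?thesis using that eventually_happens[of _ "at_top :: real filter"] by auto
  qed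
  define \<rho> where "\<rho> = exp (- (2 * r) * T)"
  have flow_contr: "2 * (c * exp (- \<mu> * T))\<^sup>2 \<le> \<rho> / 2"
  proof -
    have "2 * (c * exp (- \<mu> * T))\<^sup>2 = 2 * c\<^sup>2 * exp (- T * (2 * (\<mu> - r))) * \<rho>"
      by (simp add: \<rho>_def power_mult_distrib algebra_simps flip: exp_add exp_of_nat_mult)
    also have "\<dots> \<le> 2 * c\<^sup>2 * (1 / (4 * c\<^sup>2)) * \<rho>"
      by (intro mult_left_mono mult_right_mono T) (auto simp: \<rho>_def)
    also have "\<dots> = \<rho> / 2" using c1 by simp
    finally show ?thesis .
  qed
  define \<delta> where "\<delta> = \<rho> / 6"
  have \<rho>: "0 < \<rho>" by (simp add: \<rho>_def)
  have \<delta>: "0 < \<delta>" using \<rho> by (simp add: \<delta>_def)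
  define A where "A = a / \<alpha>"
  define B where "B = 2 * b"
  have AB: "0 \<le> A" "0 \<le> B" using a b \<alpha> by (auto simp: A_def B_def)
  have "\<forall>\<^sub>F R in at_top. 0 < R \<and> A * B / R \<le> \<alpha> \<and> A / R \<le> \<delta> \<and> A * B * c\<^sup>2 * T / R \<le> \<delta> \<and>
      B * (\<delta> + c\<^sup>2) / R \<le> \<delta> / 2 \<and> exp (- R * T) \<le> \<delta> / 2"
    using \<alpha> \<delta> T(1)
    by (intro eventually_conj eventually_gt_at_top eventually_divide_le eventually_exp_neg_le) auto
  then show ?thesis
  proof eventually_elim
    case (elim R)
    show ?case
    proof (intro allI impI)
      fix m V assume pair: "slow_fast_pair g q a b R m V"
      define Y where "Y t = (norm (m t - q))\<^sup>2 + V t" for t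
      have V: "0 \<le> V t" if "0 \<le> t" for t
        using pair that unfolding slow_fast_pair_def by blast
      have window: "(norm (m (s + u) - q))\<^sup>2 \<le> 2 * (c * exp (- \<mu> * u))\<^sup>2 * (norm (m s - q))\<^sup>2 + 2 * \<delta> * Y s"
        "V (s + u) \<le> exp (- R * u) * V s + \<delta> / 2 * Y s"
        if su: "0 \<le> s" "0 \<le> u" "u \<le> T" for s u
      proof -
        have lip': "L-lipschitz_on UNIV (\<lambda>x. - g x)"
          using lip by (simp add: lipschitz_on_def dist_minus)
        obtain \<phi> where \<phi>: "solution_of (\<lambda>x. - g x) \<phi>" "\<phi> 0 = m s"
          using lipschitz_solution_exists[OF lip', of "m s"] by blast
        have pair': "slow_fast_pair g q (\<alpha> * A) (B / 2) R (\<lambda>t. m (s + t)) (\<lambda>t. V (s + t))"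
          using slow_fast_pair_shift[OF pair su(1)] \<alpha> by (simp add: A_def B_def)
        have \<phi>_bound: "norm (\<phi> t - q) \<le> c * norm (m s - q)" if "0 \<le> t" for t
        proof -
          have "norm (\<phi> t - q) \<le> c * exp (- \<mu> * t) * norm (m s - q)" using c[OF \<phi>(1) that] \<phi>(2) by simp
          also have "\<dots> \<le> c * 1 * norm (m s - q)"
            using c1 r that by (intro mult_right_mono mult_left_mono) auto
          finally show ?thesis by simp
        qed
        have w: "(norm (m (s + u) - \<phi> u))\<^sup>2 \<le> \<delta> * Y s"
          "V (s + u) \<le> exp (- R * u) * V s + \<delta> / 2 * Y s"
          using slow_fast_window[OF mono \<alpha> pair', of \<phi> c \<delta> T u] \<phi> \<phi>_bound elim AB su
          by (simp_all add: Y_def)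
        show "V (s + u) \<le> exp (- R * u) * V s + \<delta> / 2 * Y s" by (rule w(2))
        have "(norm (\<phi> u - q))\<^sup>2 \<le> (c * exp (- \<mu> * u))\<^sup>2 * (norm (m s - q))\<^sup>2"
          using power_mono[OF c[OF \<phi>(1) su(2)], of 2] \<phi>(2) by (simp add: power_mult_distrib)
        then show "(norm (m (s + u) - q))\<^sup>2 \<le> 2 * (c * exp (- \<mu> * u))\<^sup>2 * (norm (m s - q))\<^sup>2 + 2 * \<delta> * Y s"
          using norm_sq_add_le[of "m (s + u) - \<phi> u" "\<phi> u - q"] w(1) by simp
      qed
      have "Y t \<le> (2 * c\<^sup>2 + 3 * \<delta> + 1) * exp (2 * r * T) * Y 0 * exp (- (2 * r) * t)" if "0 \<le> t" for t
      proof (rule exponential_decay_of_window_contraction[where T = T])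
        fix s :: real assume s: "0 \<le> s"
        show Ys: "0 \<le> Y s" using V[OF s] by (simp add: Y_def)
        have le: "(norm (m s - q))\<^sup>2 \<le> Y s" "V s \<le> Y s" using V[OF s] by (simp_all add: Y_def)
        show "Y (s + T) \<le> exp (- (2 * r) * T) * Y s"
        proof -
          have "(norm (m (s + T) - q))\<^sup>2 \<le> \<rho> / 2 * (norm (m s - q))\<^sup>2 + 2 * \<delta> * Y s"
            using window(1)[OF s, of T] T(1) mult_right_mono[OF flow_contr, of "(norm (m s - q))\<^sup>2"]
            by simp
          moreover have "\<rho> / 2 * (norm (m s - q))\<^sup>2 \<le> \<rho> / 2 * Y s"
            using \<rho> le by (intro mult_left_mono) auto
          moreover have "V (s + T) \<le> \<delta> / 2 * Y s + \<delta> / 2 * Y s"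
          proof -
            have "exp (- R * T) * V s \<le> \<delta> / 2 * Y s"
              using elim le V[OF s] \<delta> by (intro mult_mono) auto
            then show ?thesis using window(2)[OF s, of T] T(1) by simp
          qed
          ultimately show ?thesis
            unfolding Y_def[of "s + T"] \<rho>_def[symmetric] by (simp add: \<delta>_def)
        qed
        show "Y (s + u) \<le> (2 * c\<^sup>2 + 3 * \<delta> + 1) * Y s" if u: "0 \<le> u" "u \<le> T" for u
        proof -
          have "(c * exp (- \<mu> * u))\<^sup>2 \<le> c\<^sup>2"
            using c1 r u by (intro power_mono mult_left_le) auto
          then have "2 * (c * exp (- \<mu> * u))\<^sup>2 * (norm (m s - q))\<^sup>2 \<le> 2 * c\<^sup>2 * Y s"
            using le Ys by (intro mult_mono) auto
          moreover have "exp (- R * u) * V s \<le> 1 * Y s"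
            using elim u le V[OF s] by (intro mult_mono) auto
          moreover have "0 \<le> \<delta> * Y s" using \<delta> Ys by simp
          ultimately show ?thesis
            using window[OF s u] by (simp add: Y_def[of "s + u"] algebra_simps)
        qed
      qed (use T r \<delta> that in auto)
      then show "\<exists>K. \<forall>t\<ge>0. (norm (m t - q))\<^sup>2 + V t \<le> K * exp (- (2 * r) * t)"
        unfolding Y_def by blast
    qed
  qed
qed

section \<open>Energy of the disagreement\<close>

text \<open>The cross term \<open>\<gamma> (x \<bullet> \<eta>)\<close> makes the energy dissipate in \<open>\<eta>\<close>, which the plain sum of squares does not.\<close>

definition cross_energy :: "real \<Rightarrow> 'a::real_inner \<Rightarrow> 'a \<Rightarrow> real" where
  "cross_energy \<gamma> x \<eta> = (x \<bullet> x + \<eta> \<bullet> \<eta>) / 2 + \<gamma> * (x \<bullet> \<eta>)"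

lemma cross_energy_bounds:
  assumes "0 \<le> \<gamma>" and "\<gamma> \<le> 1 / 2"
  shows "(norm x)\<^sup>2 + (norm \<eta>)\<^sup>2 \<le> 4 * cross_energy \<gamma> x \<eta>"
    and "cross_energy \<gamma> x \<eta> \<le> (norm x)\<^sup>2 + (norm \<eta>)\<^sup>2"
proof -
  have "\<bar>x \<bullet> \<eta>\<bar> \<le> ((norm x)\<^sup>2 + (norm \<eta>)\<^sup>2) / 2"
    using young_inner[of 1 x \<eta>] young_inner[of 1 x "- \<eta>"] by (simp add: abs_le_iff)
  then have "\<bar>\<gamma> * (x \<bullet> \<eta>)\<bar> \<le> 1 / 2 * (((norm x)\<^sup>2 + (norm \<eta>)\<^sup>2) / 2)"
    using assms unfolding abs_mult by (intro mult_mono) auto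
  then have "4 * (\<gamma> * (x \<bullet> \<eta>)) \<le> x \<bullet> x + \<eta> \<bullet> \<eta>" "- 4 * (\<gamma> * (x \<bullet> \<eta>)) \<le> x \<bullet> x + \<eta> \<bullet> \<eta>"
    by (simp_all add: abs_le_iff power2_norm_eq_inner)
  then show "(norm x)\<^sup>2 + (norm \<eta>)\<^sup>2 \<le> 4 * cross_energy \<gamma> x \<eta>"
    and "cross_energy \<gamma> x \<eta> \<le> (norm x)\<^sup>2 + (norm \<eta>)\<^sup>2"
    unfolding cross_energy_def power2_norm_eq_inner
    using inner_ge_zero[of x] inner_ge_zero[of \<eta>] by argo+
qed

text \<open>The weight \<open>\<gamma> = k / P\<close> balances the two parts: the cross term contributes the wanted
  \<open>- (k\<^sup>2 / P) (\<eta> \<bullet> laplacian E \<eta>)\<close> together with the mixed form \<open>- k (x \<bullet> laplacian E \<eta>)\<close>, and Young's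
  inequality with parameter \<open>P / k\<close> splits the latter into half of the available dissipation
  in \<open>x\<close> and half of that in \<open>\<eta>\<close>. The forcing \<open>u\<close> is then absorbed for large \<open>P\<close>; it acts on \<open>\<eta>\<close> only
  through \<open>\<gamma>\<close>, so \<open>k\<^sup>2 / P\<close> being small does no harm.\<close>

lemma cross_energy_dissipation:
  fixes x \<eta> u :: "'a::euclidean_space ^ 'v::finite"
  assumes "sym E" and gap: "l * (norm x)\<^sup>2 \<le> x \<bullet> laplacian E x" "l * (norm \<eta>)\<^sup>2 \<le> \<eta> \<bullet> laplacian E \<eta>"
    and k: "0 < k" "2 * k \<le> P" and \<beta>: "0 < \<beta>" and \<kappa>: "0 \<le> \<kappa>" and \<epsilon>: "0 \<le> \<epsilon>"
    and u: "norm u \<le> \<kappa> * (\<epsilon> + norm x)"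
    and large: "8 * (\<kappa>\<^sup>2 / (2 * \<beta>) + 3 * \<kappa> / 2) \<le> l * P"
    and x': "x' = - (P *\<^sub>R laplacian E x) - k *\<^sub>R laplacian E \<eta> + u"
    and \<eta>': "\<eta>' = k *\<^sub>R laplacian E x"
  shows "x \<bullet> x' + \<eta> \<bullet> \<eta>' + k / P * (x \<bullet> \<eta>' + x' \<bullet> \<eta>)
    \<le> - (l * P / 8) * (norm x)\<^sup>2 - (l * (k\<^sup>2 / P) / 4) * (norm \<eta>)\<^sup>2 + \<beta> * \<epsilon>\<^sup>2"
proof -
  have P: "0 < P" using k by simp
  define M where "M = \<kappa>\<^sup>2 / (2 * \<beta>) + 3 * \<kappa> / 2"
  define qx where "qx = x \<bullet> laplacian E x"
  define q\<eta> where "q\<eta> = \<eta> \<bullet> laplacian E \<eta>"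
  define mix where "mix = x \<bullet> laplacian E \<eta>"
  have qx: "0 \<le> qx" and q\<eta>: "0 \<le> q\<eta>" unfolding qx_def q\<eta>_def by (rule laplacian_nonneg[OF \<open>sym E\<close>])+
  have sa: "\<eta> \<bullet> laplacian E x = mix" "laplacian E x \<bullet> \<eta> = mix" "laplacian E \<eta> \<bullet> \<eta> = q\<eta>"
    using laplacian_self_adjoint[OF \<open>sym E\<close>, of x \<eta>] by (simp_all add: mix_def q\<eta>_def inner_commute)
  have expand: "x \<bullet> x' + \<eta> \<bullet> \<eta>' + k / P * (x \<bullet> \<eta>' + x' \<bullet> \<eta>)
      = - (P * qx) + k\<^sup>2 / P * qx - k * mix - k\<^sup>2 / P * q\<eta> + (u \<bullet> x + k / P * (u \<bullet> \<eta>))"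
  proof -
    have e1: "x \<bullet> x' = - P * qx - k * mix + u \<bullet> x"
      by (simp add: x' inner_simps qx_def mix_def inner_commute)
    have e2: "\<eta> \<bullet> \<eta>' = k * mix" by (simp add: \<eta>' sa)
    have e3: "x \<bullet> \<eta>' = k * qx" by (simp add: \<eta>' qx_def)
    have e4: "x' \<bullet> \<eta> = - P * mix - k * q\<eta> + u \<bullet> \<eta>" by (simp add: x' inner_simps sa)
    show ?thesis unfolding e1 e2 e3 e4 using P by (simp add: field_simps power2_eq_square)
  qed
  have young: "- (k * mix) \<le> (P * qx) / 2 + (k\<^sup>2 / P * q\<eta>) / 2"
  proof -
    have "- mix \<le> P / k / 2 * qx + 1 / (2 * (P / k)) * q\<eta>"
      unfolding mix_def qx_def q\<eta>_def
      by (rule laplacian_form_young[OF \<open>sym E\<close>]) (use P k in simp)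
    then have "k * - mix \<le> k * (P / k / 2 * qx + 1 / (2 * (P / k)) * q\<eta>)"
      using k by (intro mult_left_mono) auto
    also have "\<dots> = (P * qx) / 2 + (k\<^sup>2 / P * q\<eta>) / 2"
      using k P by (simp add: field_simps power2_eq_square)
    finally show ?thesis by simp
  qed
  have "k\<^sup>2 / P \<le> P / 4"
  proof -
    have "(2 * k)\<^sup>2 \<le> P\<^sup>2" using k by (intro power_mono) auto
    then show ?thesis using P by (simp add: field_simps power2_eq_square)
  qed
  then have "k\<^sup>2 / P * qx \<le> P / 4 * qx" using qx by (rule mult_right_mono)
  then have "k\<^sup>2 / P * qx \<le> (P * qx) / 4" by simp
  then have main: "x \<bullet> x' + \<eta> \<bullet> \<eta>' + k / P * (x \<bullet> \<eta>' + x' \<bullet> \<eta>)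
      \<le> - (P * qx) / 4 - (k\<^sup>2 / P * q\<eta>) / 2 + (u \<bullet> x + k / P * (u \<bullet> \<eta>))"
    using young unfolding expand by argo
  define y where "y = norm x"
  define z where "z = k / P * norm \<eta>"
  have yz: "0 \<le> y" "0 \<le> z" using k P by (simp_all add: y_def z_def)
  have forcing: "u \<bullet> x + k / P * (u \<bullet> \<eta>) \<le> \<beta> * \<epsilon>\<^sup>2 + M * (y\<^sup>2 + z\<^sup>2)"
  proof -
    have "u \<bullet> x + k / P * (u \<bullet> \<eta>) \<le> norm u * norm x + k / P * (norm u * norm \<eta>)"
      using k P by (intro add_mono mult_left_mono norm_cauchy_schwarz) auto
    also have "\<dots> = norm u * (y + z)" by (simp add: y_def z_def algebra_simps)
    also have "\<dots> \<le> \<kappa> * (\<epsilon> + y) * (y + z)"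
      using u yz by (intro mult_right_mono) (auto simp: y_def)
    also have "\<dots> = \<epsilon> * (\<kappa> * y) + \<epsilon> * (\<kappa> * z) + \<kappa> * y\<^sup>2 + \<kappa> * (y * z)"
      by (simp add: algebra_simps power2_eq_square)
    also have "\<dots> \<le> (\<beta> / 2 * \<epsilon>\<^sup>2 + \<kappa>\<^sup>2 / (2 * \<beta>) * y\<^sup>2) + (\<beta> / 2 * \<epsilon>\<^sup>2 + \<kappa>\<^sup>2 / (2 * \<beta>) * z\<^sup>2)
        + (\<kappa> * y\<^sup>2 + \<kappa> * z\<^sup>2) + \<kappa> / 2 * (y\<^sup>2 + z\<^sup>2)"
    proof -
      have "\<epsilon> * (\<kappa> * v) \<le> \<beta> / 2 * \<epsilon>\<^sup>2 + \<kappa>\<^sup>2 / (2 * \<beta>) * v\<^sup>2" for v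
        using young_inner[OF \<beta>, of \<epsilon> "\<kappa> * v"] by (simp add: power_mult_distrib field_simps)
      moreover have "\<kappa> * (y * z) \<le> \<kappa> * ((y\<^sup>2 + z\<^sup>2) / 2)"
        using young_inner[of 1 y z] \<kappa> by (intro mult_left_mono) auto
      moreover have "0 \<le> \<kappa> * z\<^sup>2" using \<kappa> by simp
      ultimately show ?thesis by (smt (verit) times_divide_eq_left times_divide_eq_right)
    qed
    also have "\<dots> = \<beta> * \<epsilon>\<^sup>2 + M * (y\<^sup>2 + z\<^sup>2)"
      by (simp add: M_def algebra_simps add_divide_distrib)
    finally show ?thesis .
  qed
  have "P / 4 * (l * y\<^sup>2) \<le> P / 4 * qx" "k\<^sup>2 / P / 2 * (l * (norm \<eta>)\<^sup>2) \<le> k\<^sup>2 / P / 2 * q\<eta>"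
    using gap P by (intro mult_left_mono; simp add: y_def qx_def q\<eta>_def)+
  moreover have "M * y\<^sup>2 \<le> l * P / 8 * y\<^sup>2"
    using large by (intro mult_right_mono) (auto simp: M_def)
  moreover have "M * z\<^sup>2 \<le> l * (k\<^sup>2 / P) / 4 * (norm \<eta>)\<^sup>2"
  proof -
    have "0 \<le> M" using \<kappa> \<beta> by (simp add: M_def)
    then have "M \<le> l * P / 4" using large by (simp add: M_def)
    then have "M * z\<^sup>2 \<le> l * P / 4 * z\<^sup>2" by (rule mult_right_mono) simp
    also have "\<dots> = l * (k\<^sup>2 / P) / 4 * (norm \<eta>)\<^sup>2"
      using P by (simp add: z_def power_mult_distrib power_divide power2_eq_square mult.commute mult.left_commute)
    finally show ?thesis .
  qed
  ultimately show ?thesis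
    using main forcing by (simp add: y_def algebra_simps)
qed

section \<open>Exponential convergence\<close>

lemma converges_exponentially_of_sq:
  fixes p :: "real \<Rightarrow> 'a::real_normed_vector"
  assumes "\<And>t. 0 \<le> t \<Longrightarrow> (norm (p t - q))\<^sup>2 \<le> K * exp (- (2 * r) * t)"
  shows "converges_exponentially p q r"
  unfolding converges_exponentially_def
proof (intro exI allI impI)
  fix t :: real assume t: "0 \<le> t"
  have "norm (p t - q) \<le> sqrt (K * exp (- (2 * r) * t))"
    by (rule real_le_rsqrt[OF assms[OF t]])
  also have "exp (- (2 * r) * t) = (exp (- r * t))\<^sup>2"
    by (simp flip: exp_of_nat_mult)
  also have "sqrt (K * (exp (- r * t))\<^sup>2) = sqrt K * exp (- r * t)"
    by (simp add: real_sqrt_mult)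
  finally show "norm (p t - q) \<le> sqrt K * exp (- r * t)" .
qed

lemma converges_exponentially_imp_tendsto:
  fixes p :: "real \<Rightarrow> 'a::real_normed_vector"
  assumes "converges_exponentially p q r" and "0 < r"
  shows "(p \<longlongrightarrow> q) at_top"
proof -
  obtain C where C: "\<And>t. 0 \<le> t \<Longrightarrow> norm (p t - q) \<le> C * exp (- r * t)"
    using assms(1) unfolding converges_exponentially_def by blast
  have "filterlim (\<lambda>t. - r * t) at_bot at_top"
    using filterlim_tendsto_neg_mult_at_bot[OF tendsto_const _ filterlim_ident, of "- r"] assms(2) by simp
  then have "((\<lambda>t. exp (- r * t)) \<longlongrightarrow> 0) at_top"
    by (rule filterlim_compose[OF exp_at_bot])
  from tendsto_mult_right_zero[OF this, of C]
  have lim: "((\<lambda>t. C * exp (- r * t)) \<longlongrightarrow> 0) at_top" .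
  have "((\<lambda>t. p t - q) \<longlongrightarrow> 0) at_top"
    by (rule Lim_null_comparison[OF _ lim]) (rule eventually_mono[OF eventually_ge_at_top[of 0]], rule C)
  then show ?thesis by (simp add: LIM_zero_iff)
qed

text \<open>With the gains fixed, half of the squared distance of the mean plus the energy of the disagreement,
  where \<open>X\<close> and \<open>H\<close> stand for \<open>|x|\<^sup>2\<close> and \<open>|\<eta>|\<^sup>2\<close>, is a strict Lyapunov function, because
  strong monotonicity of the mean dynamics and the dissipation \<open>p\<close> in \<open>x\<close>, of order \<open>P\<close>, dominate all coupling terms.\<close>

lemma convergence_of_fixed_gains:
  fixes m :: "real \<Rightarrow> 'a::euclidean_space"
  assumes mono: "\<And>y. \<alpha> * (norm (y - q))\<^sup>2 \<le> g y \<bullet> (y - q)" and \<alpha>: "0 < \<alpha>"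
    and dm: "\<And>t. 0 \<le> t \<Longrightarrow> (m has_vector_derivative - g (m t) + d t) (at t within {0..})"
    and d: "\<And>t. (norm (d t))\<^sup>2 \<le> \<kappa>\<^sup>2 * X t"
    and dV: "\<And>t. 0 \<le> t \<Longrightarrow> (V has_real_derivative V' t) (at t within {0..})"
    and V: "\<And>t. X t + H t \<le> 4 * V t" "\<And>t. V t \<le> X t + H t"
    and V': "\<And>t. V' t \<le> - p * X t - h * H t + \<alpha> / 4 * (norm (m t - q))\<^sup>2"
    and pos: "\<And>t. 0 \<le> X t" "\<And>t. 0 \<le> H t" "0 < h" and p: "\<kappa>\<^sup>2 / \<alpha> \<le> p" "0 < p"
  shows "\<exists>r>0. \<exists>K. \<forall>t\<ge>0. (norm (m t - q))\<^sup>2 + X t \<le> K * exp (- (2 * r) * t)"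
proof -
  define \<rho> where "\<rho> = min (\<alpha> / 2) (min (p / 2) h)"
  have \<rho>: "0 < \<rho>" using \<alpha> p pos by (simp add: \<rho>_def)
  have \<rho>_le: "\<rho> \<le> \<alpha> / 2" "\<rho> \<le> p / 2" "\<rho> \<le> h" by (auto simp: \<rho>_def)
  define S where "S t = (norm (m t - q))\<^sup>2" for t
  define S' where "S' t = 2 * ((m t - q) \<bullet> (- g (m t) + d t))" for t
  define W where "W t = S t / 2 + V t" for t
  have dS: "(S has_real_derivative S' t) (at t within {0..})" if "0 \<le> t" for t
  proof -
    have dmq: "((\<lambda>t. m t - q) has_vector_derivative - g (m t) + d t) (at t within {0..})"
      using dm[OF that] by (auto intro!: derivative_eq_intros)
    show ?thesis
      using has_real_derivative_inner[OF dmq dmq]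
      by (simp add: S_def[abs_def] S'_def power2_norm_eq_inner inner_commute)
  qed
  have dW: "(W has_real_derivative S' t / 2 + V' t) (at t within {0..})" if "0 \<le> t" for t
    unfolding W_def by (intro DERIV_add DERIV_cdivide dS dV that)
  have W': "S' t / 2 + V' t \<le> - \<rho> * W t + 0" for t
  proof -
    have "S' t / 2 = - (g (m t) \<bullet> (m t - q)) + (m t - q) \<bullet> d t"
      by (simp add: S'_def inner_simps inner_commute)
    moreover have "2 * ((m t - q) \<bullet> d t) \<le> \<alpha> * S t + \<kappa>\<^sup>2 / \<alpha> * X t"
      using young_inner[OF \<alpha>, of "m t - q" "d t"] divide_right_mono[OF d[of t], of \<alpha>] \<alpha>
      by (simp add: S_def)
    moreover have "\<kappa>\<^sup>2 / \<alpha> * X t \<le> p * X t" by (rule mult_right_mono[OF p(1) pos(1)])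
    ultimately have "S' t / 2 + V' t \<le> - (\<alpha> / 4) * S t - p / 2 * X t - h * H t"
      using mono[of "m t"] V'[of t] unfolding S_def by linarith
    moreover have "\<rho> * (S t / 2) \<le> \<alpha> / 2 * (S t / 2)" "\<rho> * X t \<le> p / 2 * X t" "\<rho> * H t \<le> h * H t"
      by (intro mult_right_mono \<rho>_le pos; simp add: S_def)+
    moreover have "\<rho> * V t \<le> \<rho> * (X t + H t)" using V(2) \<rho> by simp
    ultimately show ?thesis by (simp add: W_def algebra_simps)
  qed
  have decay: "W t \<le> exp (- \<rho> * t) * W 0" if "0 \<le> t" for t
    using exponential_decay_of_derivative_le[OF dW W' that order_refl \<rho> order_refl] by simp
  have "S t + X t \<le> 4 * W 0 * exp (- (2 * (\<rho> / 2)) * t)" if "0 \<le> t" for t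
  proof -
    have "S t + X t \<le> 4 * W t" using V(1)[of t] pos(2)[of t] zero_le_power2[of "norm (m t - q)"]
      unfolding W_def S_def by argo
    also have "4 * W t \<le> 4 * (exp (- \<rho> * t) * W 0)" using decay[OF that] by simp
    also have "\<dots> = 4 * W 0 * exp (- (2 * (\<rho> / 2)) * t)" by simp
    finally show ?thesis .
  qed
  then show ?thesis
    using \<rho> unfolding S_def by (intro exI[of _ "\<rho> / 2"] conjI exI[of _ "4 * W 0"]) auto
qed


section \<open>Proportional-integral consensus dynamics\<close>

lemma norm_agent_sq_le:
  "(norm (W $ i - p))\<^sup>2 \<le> 2 * (norm (agent_mean W - p))\<^sup>2 + 2 * (norm (disagreement W))\<^sup>2"
  for W :: "'b::euclidean_space ^ 'w::finite"
proof -
  have "(norm (W $ i - p))\<^sup>2 \<le> 2 * (norm (agent_mean W - p))\<^sup>2 + 2 * (norm (disagreement W $ i))\<^sup>2"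
    using norm_sq_add_le[of "agent_mean W - p" "disagreement W $ i"] by (simp add: disagreement_def)
  also have "(norm (disagreement W $ i))\<^sup>2 \<le> (norm (disagreement W))\<^sup>2"
    by (intro power_mono Finite_Cartesian_Product.norm_nth_le) simp
  finally show ?thesis by simp
qed

text \<open>The setting with the agents' states stacked into one vector: \<open>G\<close> applies to each block
  the gradient of that agent. The bound \<open>\<kappa>\<close> below is the Lipschitz constant \<open>L\<close> times a
  bound for the norm of the map \<open>consensus\<close>.\<close>

locale pi_consensus =
  fixes E :: "('v::finite \<times> 'v) set"
    and G :: "'a::euclidean_space ^ 'v \<Rightarrow> 'a ^ 'v"
    and L \<alpha> :: real
    and q :: 'a
  assumes graph: "connected_undirected_graph E"
    and L: "0 \<le> L"
    and lip: "\<And>x y. norm (G x - G y) \<le> L * norm (x - y)"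
    and \<alpha>: "0 < \<alpha>"
    and mono: "\<And>a b. \<alpha> * (norm (a - b))\<^sup>2
      \<le> (agent_mean (G (consensus a)) - agent_mean (G (consensus b))) \<bullet> (a - b)"
    and opt: "agent_mean (G (consensus q)) = 0"
begin

definition mean_field :: "'a \<Rightarrow> 'a" where
  "mean_field y = agent_mean (G (consensus y))"

definition \<kappa> :: real where
  "\<kappa> = L * real CARD('v)"

definition solution :: "real \<Rightarrow> real \<Rightarrow> (real \<Rightarrow> 'a ^ 'v) \<Rightarrow> (real \<Rightarrow> 'a ^ 'v) \<Rightarrow> bool" where
  "solution P k W Z \<longleftrightarrow> (\<forall>t\<ge>0.
     (W has_vector_derivative - G (W t) - P *\<^sub>R laplacian E (W t) - k *\<^sub>R laplacian E (Z t)) (at t within {0..}) \<and>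
     (Z has_vector_derivative k *\<^sub>R laplacian E (W t)) (at t within {0..}))"

lemma kappa_nonneg: "0 \<le> \<kappa>"
  using L by (simp add: \<kappa>_def)

lemma L_le_kappa: "L \<le> \<kappa>"
  using mult_left_mono[OF _ L, of 1 "real CARD('v)"] by (simp add: \<kappa>_def Suc_le_eq)

lemma mean_field_mono: "\<alpha> * (norm (a - b))\<^sup>2 \<le> (mean_field a - mean_field b) \<bullet> (a - b)"
  using mono by (simp add: mean_field_def)

lemma mean_field_zero: "mean_field q = 0"
  using opt by (simp add: mean_field_def)

lemma mean_field_lipschitz: "\<kappa>-lipschitz_on UNIV mean_field"
proof (rule lipschitz_onI)
  fix a b :: 'a
  have "dist (mean_field a) (mean_field b) \<le> norm (G (consensus a) - G (consensus b))"
    using norm_agent_mean_le[of "G (consensus a) - G (consensus b)"]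
    by (simp add: mean_field_def dist_norm linear_diff[OF linear_agent_mean])
  also have "\<dots> \<le> L * norm (consensus (a - b) :: 'a ^ 'v)"
    using lip[of "consensus a" "consensus b"] by (simp add: linear_diff[OF linear_consensus])
  also have "\<dots> \<le> L * (real CARD('v) * norm (a - b))"
    by (rule mult_left_mono[OF norm_consensus_le L])
  finally show "dist (mean_field a) (mean_field b) \<le> \<kappa> * dist a b" by (simp add: \<kappa>_def dist_norm)
qed (rule kappa_nonneg)

text \<open>In terms of mean and disagreement the system splits into a slow flow of the mean and a fast
  linear system on the mean-free subspace. The integral states are measured from an
  equilibrium \<open>\<zeta>\<close> with \<open>k laplacian E \<zeta> = - G (consensus q)\<close>, which exists because the right-hand
  side has mean zero; their own mean is projected away since it does not
  influence the dynamics.\<close>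

lemma energy_along_solution:
  assumes sol: "solution P k W Z" and k: "0 < k" "2 * k \<le> P" and \<beta>: "0 < \<beta>"
    and gap: "\<And>x :: 'a ^ 'v. agent_mean x = 0 \<Longrightarrow> l * (norm x)\<^sup>2 \<le> x \<bullet> laplacian E x"
    and large: "8 * (\<kappa>\<^sup>2 / (2 * \<beta>) + 3 * \<kappa> / 2) \<le> l * P"
  obtains d \<eta> V V' where
    "\<And>t. 0 \<le> t \<Longrightarrow> ((\<lambda>t. agent_mean (W t)) has_vector_derivative
      - mean_field (agent_mean (W t)) + d t) (at t within {0..})"
    and "\<And>t. norm (d t) \<le> \<kappa> * norm (disagreement (W t))"
    and "\<And>t. 0 \<le> t \<Longrightarrow> (V has_real_derivative V' t) (at t within {0..})"
    and "\<And>t. (norm (disagreement (W t)))\<^sup>2 + (norm (\<eta> t :: 'a ^ 'v))\<^sup>2 \<le> 4 * V t"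
    and "\<And>t. V t \<le> (norm (disagreement (W t)))\<^sup>2 + (norm (\<eta> t))\<^sup>2"
    and "\<And>t. V' t \<le> - (l * P / 8) * (norm (disagreement (W t)))\<^sup>2
      - (l * (k\<^sup>2 / P) / 4) * (norm (\<eta> t))\<^sup>2 + \<beta> * (norm (agent_mean (W t) - q))\<^sup>2"
proof -
  have "sym E" using graph by (simp add: connected_undirected_graph_def)
  have dW: "(W has_vector_derivative - G (W t) - P *\<^sub>R laplacian E (W t) - k *\<^sub>R laplacian E (Z t)) (at t within {0..})"
    and dZ: "(Z has_vector_derivative k *\<^sub>R laplacian E (W t)) (at t within {0..})" if "0 \<le> t" for t
    using sol that by (simp_all add: solution_def)
  have "agent_mean (- (inverse k *\<^sub>R G (consensus q))) = 0"
    by (simp add: linear_neg[OF linear_agent_mean] linear_scale[OF linear_agent_mean] opt)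
  from laplacian_solvable[OF graph this]
  obtain \<zeta> where \<zeta>: "agent_mean \<zeta> = 0" "laplacian E \<zeta> = - (inverse k *\<^sub>R G (consensus q))" by blast
  have k\<zeta>: "k *\<^sub>R laplacian E \<zeta> = - G (consensus q)" using k by (simp add: \<zeta>)
  define m where "m = (\<lambda>t. agent_mean (W t))"
  define x where "x = (\<lambda>t. disagreement (W t))"
  define \<eta> where "\<eta> = (\<lambda>t. disagreement (Z t) - \<zeta>)"
  have W: "W t = consensus (m t) + x t" for t by (simp add: m_def x_def disagreement_def)
  have mean0: "agent_mean (x t) = 0" "agent_mean (\<eta> t) = 0" for t
    by (simp_all add: x_def \<eta>_def \<zeta> linear_diff[OF linear_agent_mean])
  have lapW: "laplacian E (W t) = laplacian E (x t)" for t by (simp add: x_def)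
  have lapZ: "k *\<^sub>R laplacian E (Z t) = k *\<^sub>R laplacian E (\<eta> t) - G (consensus q)" for t
    by (simp add: \<eta>_def linear_diff[OF linear_laplacian] scaleR_diff_right k\<zeta>)
  have bl_mean: "bounded_linear (agent_mean :: 'a ^ 'v \<Rightarrow> 'a)"
    by (rule linear_conv_bounded_linear[THEN iffD1, OF linear_agent_mean])
  have bl_dis: "bounded_linear (disagreement :: 'a ^ 'v \<Rightarrow> 'a ^ 'v)"
    by (rule linear_conv_bounded_linear[THEN iffD1, OF linear_disagreement])
  define d where "d t = agent_mean (G (consensus (m t)) - G (W t))" for t
  define u where "u t = - disagreement (G (W t) - G (consensus q))" for t
  define x' where "x' t = - (P *\<^sub>R laplacian E (x t)) - k *\<^sub>R laplacian E (\<eta> t) + u t" for t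
  define \<eta>' where "\<eta>' t = k *\<^sub>R laplacian E (x t)" for t
  note mean_simps = linear_diff[OF linear_agent_mean] linear_neg[OF linear_agent_mean]
    linear_scale[OF linear_agent_mean] agent_mean_laplacian[OF \<open>sym E\<close>]
  note dis_simps = linear_diff[OF linear_disagreement] linear_neg[OF linear_disagreement]
    linear_scale[OF linear_disagreement]
  have dm: "(m has_vector_derivative - mean_field (m t) + d t) (at t within {0..})"
    if "0 \<le> t" for t
  proof -
    have "agent_mean (- G (W t) - P *\<^sub>R laplacian E (W t) - k *\<^sub>R laplacian E (Z t))
        = - mean_field (m t) + d t"
      by (simp add: mean_simps d_def mean_field_def)
    then show ?thesis
      using bounded_linear.has_vector_derivative[OF bl_mean dW[OF that]] by (simp add: m_def)
  qed
  have dx: "(x has_vector_derivative x' t) (at t within {0..})" if "0 \<le> t" for t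
  proof -
    have "disagreement (- G (W t) - P *\<^sub>R laplacian E (W t) - k *\<^sub>R laplacian E (Z t)) = x' t"
      unfolding lapZ lapW
      by (simp add: dis_simps u_def x'_def disagreement_eq_self agent_mean_laplacian[OF \<open>sym E\<close>])
    then show ?thesis
      using bounded_linear.has_vector_derivative[OF bl_dis dW[OF that]] by (simp add: x_def)
  qed
  have d\<eta>: "(\<eta> has_vector_derivative \<eta>' t) (at t within {0..})" if "0 \<le> t" for t
  proof -
    have "disagreement (k *\<^sub>R laplacian E (W t)) = \<eta>' t"
      by (simp add: dis_simps \<eta>'_def lapW disagreement_eq_self agent_mean_laplacian[OF \<open>sym E\<close>])
    then show ?thesis
      using has_vector_derivative_diff[OF bounded_linear.has_vector_derivative[OF bl_dis dZ[OF that]]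
          has_vector_derivative_const[of \<zeta>]]
      by (simp add: \<eta>_def)
  qed
  have d_le: "norm (d t) \<le> \<kappa> * norm (x t)" for t
  proof -
    have "norm (d t) \<le> norm (G (consensus (m t)) - G (W t))" unfolding d_def by (rule norm_agent_mean_le)
    also have "\<dots> \<le> L * norm (x t)" using lip[of "consensus (m t)" "W t"] by (simp add: W)
    also have "\<dots> \<le> \<kappa> * norm (x t)" by (rule mult_right_mono[OF L_le_kappa]) simp
    finally show ?thesis .
  qed
  have u_le: "norm (u t) \<le> \<kappa> * (norm (m t - q) + norm (x t))" for t
  proof -
    have "norm (u t) \<le> norm (G (W t) - G (consensus q))"
      unfolding u_def norm_minus_cancel by (rule norm_disagreement_le)
    also have "\<dots> \<le> L * norm (W t - consensus q)" by (rule lip)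
    also have "W t - consensus q = consensus (m t - q) + x t"
      by (simp add: W linear_diff[OF linear_consensus])
    also have "L * norm \<dots> \<le> L * (real CARD('v) * norm (m t - q) + norm (x t))"
      by (intro mult_left_mono L order_trans[OF norm_triangle_ineq] add_right_mono norm_consensus_le)
    also have "\<dots> \<le> \<kappa> * (norm (m t - q) + norm (x t))"
      using mult_right_mono[OF L_le_kappa, of "norm (x t)"] by (simp add: \<kappa>_def algebra_simps)
    finally show ?thesis .
  qed
  define V where "V t = cross_energy (k / P) (x t) (\<eta> t)" for t
  define V' where "V' t = x t \<bullet> x' t + \<eta> t \<bullet> \<eta>' t + k / P * (x t \<bullet> \<eta>' t + x' t \<bullet> \<eta> t)" for t
  have kP: "0 \<le> k / P" "k / P \<le> 1 / 2" using k by (simp_all add: field_simps)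
  have dV: "(V has_real_derivative V' t) (at t within {0..})" if "0 \<le> t" for t
  proof -
    have "V' t = (x t \<bullet> x' t + x' t \<bullet> x t + (\<eta> t \<bullet> \<eta>' t + \<eta>' t \<bullet> \<eta> t)) / 2
        + k / P * (x t \<bullet> \<eta>' t + x' t \<bullet> \<eta> t)"
      by (simp add: V'_def inner_commute)
    then show ?thesis
      unfolding V_def cross_energy_def
      by (simp only:) (intro DERIV_add DERIV_cdivide DERIV_cmult has_real_derivative_inner dx d\<eta> that)
  qed
  show thesis
  proof (rule that[of d V V' \<eta>])
    show "((\<lambda>t. agent_mean (W t)) has_vector_derivative
      - mean_field (agent_mean (W t)) + d t) (at t within {0..})" if "0 \<le> t" for t
      using dm[OF that] by (simp add: m_def)
    show "norm (d t) \<le> \<kappa> * norm (disagreement (W t))" for t using d_le by (simp add: x_def)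
    show "(norm (disagreement (W t)))\<^sup>2 + (norm (\<eta> t))\<^sup>2 \<le> 4 * V t"
      "V t \<le> (norm (disagreement (W t)))\<^sup>2 + (norm (\<eta> t))\<^sup>2" for t
      using cross_energy_bounds[OF kP, of "x t" "\<eta> t"] by (simp_all add: V_def x_def)
    show "V' t \<le> - (l * P / 8) * (norm (disagreement (W t)))\<^sup>2
      - (l * (k\<^sup>2 / P) / 4) * (norm (\<eta> t))\<^sup>2 + \<beta> * (norm (agent_mean (W t) - q))\<^sup>2" for t
      using cross_energy_dissipation[OF \<open>sym E\<close> gap[OF mean0(1)[of t]] gap[OF mean0(2)[of t]] k \<beta> kappa_nonneg norm_ge_zero
          u_le[of t] large x'_def[of t] \<eta>'_def[of t]]
      by (simp add: V'_def x_def m_def)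
  qed (fact dV)
qed

lemma converges_for_large_gain:
  assumes k: "0 < k"
  shows "\<forall>\<^sub>F P in at_top. \<forall>W Z i. solution P k W Z \<longrightarrow> ((\<lambda>t. W t $ i) \<longlongrightarrow> q) at_top"
proof -
  obtain l where l: "0 < l"
    and gap: "\<And>x :: 'a ^ 'v. agent_mean x = 0 \<Longrightarrow> l * (norm x)\<^sup>2 \<le> x \<bullet> laplacian E x"
    using laplacian_spectral_gap[OF graph, where 'a = 'a] by blast
  define M where "M = 8 * (\<kappa>\<^sup>2 / (2 * (\<alpha> / 4)) + 3 * \<kappa> / 2)"
  (* P >= M / l absorbs the forcing of the disagreement, and the last bound makes the dissipation in x
     dominate the error that the disagreement causes in the mean. *)
  have "\<forall>\<^sub>F P in at_top. max (2 * k) (max (M / l) (8 * (\<kappa>\<^sup>2 / \<alpha>) / l)) \<le> P"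
    by (rule eventually_ge_at_top)
  then show ?thesis
  proof eventually_elim
    case (elim P)
    then have "M / l \<le> P" "8 * (\<kappa>\<^sup>2 / \<alpha>) / l \<le> P" by simp_all
    then have "M \<le> P * l" "8 * (\<kappa>\<^sup>2 / \<alpha>) \<le> P * l"
      using l by (simp_all only: pos_divide_le_eq)
    then have P: "2 * k \<le> P" "M \<le> l * P" "\<kappa>\<^sup>2 / \<alpha> \<le> l * P / 8"
      using elim by (simp_all add: mult.commute)
    show ?case
    proof (intro allI impI)
      fix W Z i assume sol: "solution P k W Z"
      obtain d \<eta> V V' where red:
        "\<And>t. 0 \<le> t \<Longrightarrow> ((\<lambda>t. agent_mean (W t)) has_vector_derivative
          - mean_field (agent_mean (W t)) + d t) (at t within {0..})"
        "\<And>t. norm (d t) \<le> \<kappa> * norm (disagreement (W t))"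
        "\<And>t. 0 \<le> t \<Longrightarrow> (V has_real_derivative V' t) (at t within {0..})"
        "\<And>t. (norm (disagreement (W t)))\<^sup>2 + (norm (\<eta> t :: 'a ^ 'v))\<^sup>2 \<le> 4 * V t"
        "\<And>t. V t \<le> (norm (disagreement (W t)))\<^sup>2 + (norm (\<eta> t))\<^sup>2"
        "\<And>t. V' t \<le> - (l * P / 8) * (norm (disagreement (W t)))\<^sup>2
          - (l * (k\<^sup>2 / P) / 4) * (norm (\<eta> t))\<^sup>2 + \<alpha> / 4 * (norm (agent_mean (W t) - q))\<^sup>2"
        by (rule energy_along_solution[OF sol k P(1) _ gap P(2)[unfolded M_def]]) (use \<alpha> in auto)
      have "\<exists>r>0. \<exists>K. \<forall>t\<ge>0. (norm (agent_mean (W t) - q))\<^sup>2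
          + (norm (disagreement (W t)))\<^sup>2 \<le> K * exp (- (2 * r) * t)"
      proof (rule convergence_of_fixed_gains[OF _ \<alpha> red(1) _ red(3,4,5,6)])
        show "\<alpha> * (norm (y - q))\<^sup>2 \<le> mean_field y \<bullet> (y - q)" for y
          using mean_field_mono[of y q] by (simp add: mean_field_zero)
        show "(norm (d t))\<^sup>2 \<le> \<kappa>\<^sup>2 * (norm (disagreement (W t)))\<^sup>2" for t
          using power_mono[OF red(2)[of t], of 2] by (simp add: power_mult_distrib)
      qed (use k P l in auto)
      then obtain r K where r: "0 < r" and
        K: "\<And>t. 0 \<le> t \<Longrightarrow> (norm (agent_mean (W t) - q))\<^sup>2
          + (norm (disagreement (W t)))\<^sup>2 \<le> K * exp (- (2 * r) * t)" by blast
      have "converges_exponentially (\<lambda>t. W t $ i) q r"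
      proof (rule converges_exponentially_of_sq[where K = "2 * K"])
        show "(norm (W t $ i - q))\<^sup>2 \<le> 2 * K * exp (- (2 * r) * t)" if "0 \<le> t" for t
          using norm_agent_sq_le[of "W t" i q] K[OF that] by linarith
      qed
      then show "((\<lambda>t. W t $ i) \<longlongrightarrow> q) at_top"
        using r by (rule converges_exponentially_imp_tendsto)
    qed
  qed
qed

text \<open>With \<open>s = sqrt k\<close> the choice of the gain reads \<open>P = s ^ 3\<close> and \<open>k\<^sup>2 / P = s\<close>. The energy then decays at least at the
  rate \<open>(l / 8) s\<close>, which is unbounded in \<open>k\<close>; the condition \<open>4 \<le> k\<close> gives \<open>2 k \<le> P\<close>.\<close>

lemma converges_at_mean_field_rate:
  assumes stable: "globally_exponentially_stable (\<lambda>x. - mean_field x) q \<mu>" and r: "0 < r" "r < \<mu>"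
  shows "\<forall>\<^sub>F k in at_top. \<forall>W Z i. solution (k powr (3/2)) k W Z \<longrightarrow>
    converges_exponentially (\<lambda>t. W t $ i) q r"
proof -
  obtain l where l: "0 < l"
    and gap: "\<And>x :: 'a ^ 'v. agent_mean x = 0 \<Longrightarrow> l * (norm x)\<^sup>2 \<le> x \<bullet> laplacian E x"
    using laplacian_spectral_gap[OF graph, where 'a = 'a] by blast
  define M where "M = 8 * (\<kappa>\<^sup>2 / (2 * (\<alpha> / 4)) + 3 * \<kappa> / 2)"
  have rate: "filterlim (\<lambda>k. l / 8 * sqrt k) at_top at_top"
    using l by (intro filterlim_tendsto_pos_mult_at_top[OF tendsto_const] sqrt_at_top) auto
  have slow_fast: "\<forall>\<^sub>F R in at_top. \<forall>m V. slow_fast_pair mean_field q (4 * \<kappa>\<^sup>2) (\<alpha> / 4) R m V \<longrightarrow>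
      (\<exists>K. \<forall>t\<ge>0. (norm (m t - q))\<^sup>2 + V t \<le> K * exp (- (2 * r) * t))"
    using \<alpha> r by (intro slow_fast_exponential[OF mean_field_lipschitz mean_field_mono \<alpha> stable]) auto
  have "\<forall>\<^sub>F k in at_top. max 4 ((M / l)\<^sup>2) \<le> k" by (rule eventually_ge_at_top)
  then show ?thesis
    using eventually_compose_filterlim[OF slow_fast rate]
  proof eventually_elim
    case (elim k)
    then have k: "0 < k" "4 \<le> k" "(M / l)\<^sup>2 \<le> k" by simp_all
    show ?case
    proof (intro allI impI)
      fix W Z i assume sol0: "solution (k powr (3/2)) k W Z"
      define s where "s = sqrt k"
      have s: "2 \<le> s" "k = s\<^sup>2" "M / l \<le> s"
        using k real_le_rsqrt[of 2 k] real_le_rsqrt[of "M / l" k] by (auto simp: s_def)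
      define P where "P = k powr (3/2)"
      note sol = sol0[folded P_def]
      have Ps: "P = s ^ 3"
      proof -
        have "P = k powr (1 + 1/2)" by (simp add: P_def)
        also have "\<dots> = k * s" using k by (simp only: powr_add) (simp add: s_def powr_half_sqrt)
        finally show ?thesis by (simp add: s(2) power2_eq_square power3_eq_cube)
      qed
      have sP: "s \<le> P" using s power_increasing[of 1 3 s] by (simp add: Ps)
      have P: "2 * k \<le> P" "M \<le> l * P" "k\<^sup>2 / P = s"
      proof -
        show "2 * k \<le> P" using mult_right_mono[OF s(1), of "s\<^sup>2"] by (simp add: Ps s(2) power2_eq_square power3_eq_cube)
        have "M / l \<le> P" using s(3) sP by linarith
        then show "M \<le> l * P" using l by (simp add: pos_divide_le_eq mult.commute)
        show "k\<^sup>2 / P = s" using s(1) by (simp add: Ps s(2) power2_eq_square power3_eq_cube)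
      qed
      obtain d \<eta> V V' where red:
        "\<And>t. 0 \<le> t \<Longrightarrow> ((\<lambda>t. agent_mean (W t)) has_vector_derivative
          - mean_field (agent_mean (W t)) + d t) (at t within {0..})"
        "\<And>t. norm (d t) \<le> \<kappa> * norm (disagreement (W t))"
        "\<And>t. 0 \<le> t \<Longrightarrow> (V has_real_derivative V' t) (at t within {0..})"
        "\<And>t. (norm (disagreement (W t)))\<^sup>2 + (norm (\<eta> t :: 'a ^ 'v))\<^sup>2 \<le> 4 * V t"
        "\<And>t. V t \<le> (norm (disagreement (W t)))\<^sup>2 + (norm (\<eta> t))\<^sup>2"
        "\<And>t. V' t \<le> - (l * P / 8) * (norm (disagreement (W t)))\<^sup>2
          - (l * (k\<^sup>2 / P) / 4) * (norm (\<eta> t))\<^sup>2 + \<alpha> / 4 * (norm (agent_mean (W t) - q))\<^sup>2"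
        by (rule energy_along_solution[OF sol k(1) P(1) _ gap P(2)[unfolded M_def]]) (use \<alpha> in auto)
      have X_le: "(norm (disagreement (W t)))\<^sup>2 \<le> 4 * V t" for t
        using red(4)[of t] zero_le_power2[of "norm (\<eta> t)"] by argo
      have V_nonneg: "0 \<le> V t" for t
        using X_le[of t] zero_le_power2[of "norm (disagreement (W t))"] by argo
      have "slow_fast_pair mean_field q (4 * \<kappa>\<^sup>2) (\<alpha> / 4) (l / 8 * s) (\<lambda>t. agent_mean (W t)) V"
        unfolding slow_fast_pair_def
      proof (intro exI[of _ d] exI[of _ V'] allI impI conjI red(1) red(3) V_nonneg)
        fix t :: real
        let ?X = "(norm (disagreement (W t)))\<^sup>2" and ?H = "(norm (\<eta> t))\<^sup>2"
        have "(norm (d t))\<^sup>2 \<le> \<kappa>\<^sup>2 * ?X"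
          using power_mono[OF red(2)[of t], of 2] by (simp add: power_mult_distrib)
        also have "\<dots> \<le> \<kappa>\<^sup>2 * (4 * V t)" by (rule mult_left_mono[OF X_le]) simp
        finally show "(norm (d t))\<^sup>2 \<le> 4 * \<kappa>\<^sup>2 * V t" by simp
        have "l / 8 * s * V t \<le> l / 8 * s * (?X + ?H)"
          using l s(1) by (intro mult_left_mono red(5)) auto
        also have "\<dots> = l * s / 8 * ?X + l * s / 8 * ?H" by (simp add: algebra_simps)
        also have "\<dots> \<le> l * P / 8 * ?X + l * s / 4 * ?H"
          using l s(1) sP by (intro add_mono mult_right_mono) auto
        finally have "l / 8 * s * V t \<le> l * P / 8 * ?X + l * s / 4 * ?H" .
        then show "V' t \<le> - (l / 8 * s) * V t + \<alpha> / 4 * (norm (agent_mean (W t) - q))\<^sup>2"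
          using red(6)[of t] unfolding P(3) mult_minus_left by linarith
      qed
      then obtain K where K: "\<And>t. 0 \<le> t \<Longrightarrow> (norm (agent_mean (W t) - q))\<^sup>2 + V t
          \<le> K * exp (- (2 * r) * t)"
        using elim(2) unfolding s_def by blast
      show "converges_exponentially (\<lambda>t. W t $ i) q r"
      proof (rule converges_exponentially_of_sq[where K = "8 * K"])
        fix t :: real assume t: "0 \<le> t"
        have "(norm (W t $ i - q))\<^sup>2 \<le> 8 * ((norm (agent_mean (W t) - q))\<^sup>2 + V t)"
          using norm_agent_sq_le[of "W t" i q] X_le[of t]
            zero_le_power2[of "norm (agent_mean (W t) - q)"] by argo
        then show "(norm (W t $ i - q))\<^sup>2 \<le> 8 * K * exp (- (2 * r) * t)"
          using K[OF t] by argo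
      qed
    qed
  qed
qed

end

section \<open>Gradients\<close>

lemma gderiv_unique:
  fixes f :: "'a::euclidean_space \<Rightarrow> real"
  assumes "GDERIV f x :> D" and "GDERIV f x :> D'"
  shows "D = D'"
  using has_derivative_unique[OF assms[unfolded gderiv_def]]
  by (auto simp: fun_eq_iff intro: vector_eq_ldot[THEN iffD1])

lemma gradient_eqI: "GDERIV f x :> D \<Longrightarrow> gradient f x = D"
  for f :: "'a::euclidean_space \<Rightarrow> real"
  unfolding gradient_def by (rule the_equality) (auto intro: gderiv_unique)

lemma gderiv_gradient:
  fixes f :: "'a::euclidean_space \<Rightarrow> real"
  assumes "f differentiable (at x)"
  shows "GDERIV f x :> gradient f x"
proof -
  obtain f' where f': "(f has_derivative f') (at x)"
    using assms by (auto simp: differentiable_def)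
  have "f' = (\<lambda>h. h \<bullet> adjoint f' 1)"
    using adjoint_works[OF has_derivative_linear[OF f'], of _ 1] by (simp add: fun_eq_iff)
  then have "GDERIV f x :> adjoint f' 1" using f' by (simp add: gderiv_def)
  then show ?thesis using gradient_eqI by metis
qed

lemma gderiv_average_objective:
  fixes f :: "'v::finite \<Rightarrow> 'a::euclidean_space \<Rightarrow> real"
  assumes "\<And>i. f i differentiable (at x)"
  shows "GDERIV (average_objective f) x :> agent_mean (\<chi> i. gradient (f i) x)"
proof -
  have "((\<lambda>y. (\<Sum>i\<in>UNIV. f i y) * (1 / real CARD('v))) has_derivative
      (\<lambda>h. (\<Sum>i\<in>UNIV. h \<bullet> gradient (f i) x) * (1 / real CARD('v)))) (at x)"
    by (intro has_derivative_mult_left has_derivative_sum)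
      (use gderiv_gradient[OF assms] in \<open>simp add: gderiv_def\<close>)
  then show ?thesis
    by (simp add: gderiv_def average_objective_def[abs_def] agent_mean_def inner_sum_right
        divide_inverse mult.commute)
qed

lemma gderiv_zero_at_minimum:
  fixes f :: "'a::euclidean_space \<Rightarrow> real"
  assumes "GDERIV f x :> D" and "\<And>y. f x \<le> f y"
  shows "D = 0"
proof -
  have "(\<lambda>h. h \<bullet> D) = (\<lambda>h. 0)"
    by (rule differential_zero_maxmin[of x UNIV f]) (use assms in \<open>auto simp: gderiv_def\<close>)
  then have "D \<bullet> D = 0" by meson
  then show ?thesis by simp
qed

section \<open>The distributed algorithm\<close>

lemma has_vector_derivative_vec_lambda:
  fixes w :: "'v::finite \<Rightarrow> real \<Rightarrow> 'a::euclidean_space"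
  assumes "\<And>i. (w i has_vector_derivative w' i) (at t within S)"
  shows "((\<lambda>t. \<chi> i. w i t) has_vector_derivative (\<chi> i. w' i)) (at t within S)"
proof -
  have bl: "bounded_linear (axis i :: 'a \<Rightarrow> 'a ^ 'v)" for i
    unfolding linear_conv_bounded_linear[symmetric]
    by (rule linearI) (simp_all add: axis_def vec_eq_iff)
  have sum_axis: "(\<chi> i. v i) = (\<Sum>i\<in>UNIV. axis i (v i))" for v :: "'v \<Rightarrow> 'a"
    by (simp add: vec_eq_iff axis_def)
  show ?thesis
    unfolding sum_axis
    by (intro has_vector_derivative_sum bounded_linear.has_vector_derivative[OF bl] assms)
qed

lemma distributed_pi_solution_stacked:
  fixes f :: "'v::finite \<Rightarrow> 'a::euclidean_space \<Rightarrow> real"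
  assumes "distributed_pi_solution f E P k w \<xi>" and "0 \<le> t"
  shows "((\<lambda>t. \<chi> i. w i t) has_vector_derivative
      - (\<chi> i. gradient (f i) ((\<chi> i. w i t) $ i)) - P *\<^sub>R laplacian E (\<chi> i. w i t)
      - k *\<^sub>R laplacian E (\<chi> i. \<xi> i t)) (at t within {0..})"
    and "((\<lambda>t. \<chi> i. \<xi> i t) has_vector_derivative k *\<^sub>R laplacian E (\<chi> i. w i t)) (at t within {0..})"
proof -
  have neg: "(\<Sum>j\<in>A. a j - b) = - (\<Sum>j\<in>A. b - a j)" for A and a :: "'v \<Rightarrow> 'a" and b
    by (simp flip: sum_negf)
  have sol: "\<forall>i. (w i has_vector_derivative
           (- gradient (f i) (w i t) + P *\<^sub>R (\<Sum>j\<in>E `` {i}. w j t - w i t)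
            + k *\<^sub>R (\<Sum>j\<in>E `` {i}. \<xi> j t - \<xi> i t))) (at t within {0..})"
    "\<forall>i. (\<xi> i has_vector_derivative - (k *\<^sub>R (\<Sum>j\<in>E `` {i}. w j t - w i t))) (at t within {0..})"
    using assms unfolding distributed_pi_solution_def by blast+
  note has_vector_derivative_vec_lambda[of w, OF sol(1)[rule_format]]
    has_vector_derivative_vec_lambda[of \<xi>, OF sol(2)[rule_format]]
  moreover have "(\<chi> i. - gradient (f i) (w i t) + P *\<^sub>R (\<Sum>j\<in>E `` {i}. w j t - w i t)
            + k *\<^sub>R (\<Sum>j\<in>E `` {i}. \<xi> j t - \<xi> i t))
      = - (\<chi> i. gradient (f i) ((\<chi> i. w i t) $ i)) - P *\<^sub>R laplacian E (\<chi> i. w i t)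
      - k *\<^sub>R laplacian E (\<chi> i. \<xi> i t)"
    by (simp add: vec_eq_iff laplacian_def neg[of "\<lambda>j. w j t"] neg[of "\<lambda>j. \<xi> j t"])
  moreover have "(\<chi> i. - (k *\<^sub>R (\<Sum>j\<in>E `` {i}. w j t - w i t))) = k *\<^sub>R laplacian E (\<chi> i. w i t)"
    by (simp add: vec_eq_iff laplacian_def neg[of "\<lambda>j. w j t"])
  ultimately show "((\<lambda>t. \<chi> i. w i t) has_vector_derivative
      - (\<chi> i. gradient (f i) ((\<chi> i. w i t) $ i)) - P *\<^sub>R laplacian E (\<chi> i. w i t)
      - k *\<^sub>R laplacian E (\<chi> i. \<xi> i t)) (at t within {0..})"
    and "((\<lambda>t. \<chi> i. \<xi> i t) has_vector_derivative k *\<^sub>R laplacian E (\<chi> i. w i t)) (at t within {0..})"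
    by simp_all
qed

theorem theorem2:
  fixes f :: "'v::finite \<Rightarrow> real ^ 'n \<Rightarrow> real"
    and E :: "('v \<times> 'v) set"
    and \<alpha> :: real
    and wstar :: "real ^ 'n"
  assumes "\<And>i. continuously_differentiable (f i)"
    and "\<And>i. \<exists>L. L-lipschitz_on UNIV (gradient (f i))"
    and "\<alpha> > 0"
    and "strongly_convex \<alpha> (average_objective f)"
    and "is_arg_min (average_objective f) (\<lambda>_. True) wstar"
    and "connected_undirected_graph E"
  shows
    "(\<forall>k\<^sub>I>0. \<forall>\<^sub>F k\<^sub>P in at_top. \<forall>w \<xi>. distributed_pi_solution f E k\<^sub>P k\<^sub>I w \<xi> \<longrightarrow>
        (\<forall>i. (w i \<longlongrightarrow> wstar) at_top)) \<and>
     (\<forall>\<mu>>0. globally_exponentially_stable (\<lambda>x. - gradient (average_objective f) x) wstar \<mu> \<longrightarrow>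
        (\<forall>\<upsilon>\<in>{0<..<\<mu>}. \<exists>k>0. \<forall>k\<^sub>I>k. \<forall>w \<xi>.
           distributed_pi_solution f E (k\<^sub>I powr (3/2)) k\<^sub>I w \<xi> \<longrightarrow>
           (\<forall>i. converges_exponentially (w i) wstar (\<mu> - \<upsilon>))))"
proof -
  define G where "G x = (\<chi> i. gradient (f i) (x $ i))" for x :: "(real ^ 'n) ^ 'v"
  have gderiv: "GDERIV (average_objective f) y :> agent_mean (G (consensus y))" for y
    using gderiv_average_objective[of f y] assms(1)
    by (simp add: continuously_differentiable_def G_def)
  have grad: "gradient (average_objective f) = (\<lambda>y. agent_mean (G (consensus y)))"
    using gradient_eqI[OF gderiv] by (simp add: fun_eq_iff)
  obtain L0 where L0: "\<And>i. (L0 i)-lipschitz_on UNIV (gradient (f i))"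
    using assms(2) by metis
  define L where "L = (\<Sum>i\<in>UNIV. L0 i)"
  have L0_nonneg: "0 \<le> L0 i" for i using lipschitz_on_nonneg[OF L0] .
  have L: "0 \<le> L" unfolding L_def by (rule sum_nonneg) (simp add: L0_nonneg)
  have L0_le: "L0 i \<le> L" for i
    unfolding L_def by (rule member_le_sum) (auto simp: L0_nonneg)
  interpret pi_consensus E G L \<alpha> wstar
  proof
    show "norm (G x - G y) \<le> L * norm (x - y)" for x y
    proof -
      have "norm (G x - G y) \<le> norm (L *\<^sub>R (x - y))"
      proof (rule norm_le_componentwise_cart)
        fix i
        have "norm ((G x - G y) $ i) \<le> L0 i * norm (x $ i - y $ i)"
          using lipschitz_onD[OF L0[of i], of "x $ i" "y $ i"] by (simp add: G_def dist_norm)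
        also have "\<dots> \<le> L * norm (x $ i - y $ i)" by (rule mult_right_mono[OF L0_le]) simp
        finally show "norm ((G x - G y) $ i) \<le> norm ((L *\<^sub>R (x - y)) $ i)" using L by simp
      qed
      then show ?thesis using L by simp
    qed
    show "\<alpha> * (norm (a - b))\<^sup>2 \<le> (agent_mean (G (consensus a)) - agent_mean (G (consensus b))) \<bullet> (a - b)" for a b
      using assms(4) by (simp add: strongly_convex_def grad)
    show "agent_mean (G (consensus wstar)) = 0"
      by (rule gderiv_zero_at_minimum[OF gderiv])
        (use assms(5) in \<open>auto simp: is_arg_min_def not_less\<close>)
  qed (use assms L in auto)
  have stacked: "solution P k (\<lambda>t. \<chi> i. w i t) (\<lambda>t. \<chi> i. \<xi> i t)"
    if "distributed_pi_solution f E P k w \<xi>" for P k w \<xi>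
    unfolding solution_def G_def using distributed_pi_solution_stacked[OF that] by blast
  show ?thesis
  proof (intro conjI allI impI ballI)
    fix k :: real assume "0 < k"
    from converges_for_large_gain[OF this]
    show "\<forall>\<^sub>F P in at_top. \<forall>w \<xi>. distributed_pi_solution f E P k w \<xi> \<longrightarrow> (\<forall>i. (w i \<longlongrightarrow> wstar) at_top)"
    proof eventually_elim
      case (elim P)
      show ?case
      proof (intro allI impI)
        fix w \<xi> i assume "distributed_pi_solution f E P k w \<xi>"
        from elim[rule_format, OF stacked[OF this], of i] show "(w i \<longlongrightarrow> wstar) at_top" by simp
      qed
    qed
  next
    fix \<mu> \<upsilon> :: real
    assume "globally_exponentially_stable (\<lambda>x. - gradient (average_objective f) x) wstar \<mu>"
      and \<upsilon>: "\<upsilon> \<in> {0<..<\<mu>}"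
    then have "\<forall>\<^sub>F k in at_top. \<forall>W Z i. solution (k powr (3/2)) k W Z \<longrightarrow>
        converges_exponentially (\<lambda>t. W t $ i) wstar (\<mu> - \<upsilon>)"
      by (intro converges_at_mean_field_rate[where \<mu> = \<mu>]) (auto simp: grad mean_field_def)
    then obtain k0 where k0: "\<And>k W Z i. k0 \<le> k \<Longrightarrow> solution (k powr (3/2)) k W Z \<Longrightarrow>
        converges_exponentially (\<lambda>t. W t $ i) wstar (\<mu> - \<upsilon>)"
      unfolding eventually_at_top_linorder by blast
    show "\<exists>k>0. \<forall>k\<^sub>I>k. \<forall>w \<xi>. distributed_pi_solution f E (k\<^sub>I powr (3/2)) k\<^sub>I w \<xi> \<longrightarrow>
           (\<forall>i. converges_exponentially (w i) wstar (\<mu> - \<upsilon>))"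
    proof (intro exI[of _ "max k0 1"] conjI allI impI)
      fix k w \<xi> i
      assume "max k0 1 < k" and sol: "distributed_pi_solution f E (k powr (3/2)) k w \<xi>"
      then show "converges_exponentially (w i) wstar (\<mu> - \<upsilon>)"
        using k0[OF _ stacked[OF sol], of i] by simp
    qed simp
  qed
qed

end
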